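(* Let $1<p<s\le\infty$ and let $(R,\mu)$ be a $\sigma$-finite nonatomic measure space. Assume that $f_k\in L^{p,s}(R,\mu)$ for $k=1,\dots,N$. Then $$\left\|\sum_{k=1}^N f_k\right\|_{p,s}\le c_{p,s}\sum_{k=1}^N\|f_k\|_{p,s},\qquad\text{where}\qquad c_{p,s}=\left(\frac{p}{s}\right)^{1/s}\left(\frac{p'}{s'}\right)^{1/s'},$$ and the constant is optimal, i.e. $c_{p,s}$ cannot be replaced by a smaller constant for which the inequality holds for all such $(R,\mu)$, all $N\in\mathbb{N}$ and all $f_1,\dots,f_N\in L^{p,s}(R,\mu)$.
   Context: Functions are real-valued, measurable and finite a.e. For a $\mu$-measurable function $f$ on $R$, $f^*$ denotes its non-increasing rearrangement on $\mathbb{R}_+=(0,\infty)$. For $1<p<\infty$ and $1\le s<\infty$, $$\|f\|_{p,s}=\left(\int_0^\infty (t^{1/p}f^*(t))^s\,\frac{dt}{t}\right)^{1/s},\qquad \|f\|_{p,\infty}=\sup_{t>0}t^{1/p}f^*(t),$$ and $L^{p,s}(R,\mu)$ is the set of $f$ with $\|f\|_{p,s}<\infty$. Conjugate exponents: $1/p+1/p'=1$, $1/s+1/s'=1$ ($s'=1$ if $s=\infty$). Convention: $(p/s)^{1/s}=1$ for $s=\infty$, so $c_{p,\infty}=p'$. *)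

theory Defs
  imports "HOL-Analysis.Analysis"
begin

text \<open>The disjunction is on \<open>B\<close> and \<open>A - B\<close> rather than on the values \<open>0\<close> and \<open>\<mu> A\<close>, so that
  sets of infinite measure cause no trouble; for \<open>\<sigma>\<close>-finite measures the two versions agree.\<close>

definition nonatomic :: "'a measure \<Rightarrow> bool" where
  "nonatomic M \<longleftrightarrow>
    \<not> (\<exists>A\<in>sets M. emeasure M A > 0 \<and>
          (\<forall>B\<in>sets M. B \<subseteq> A \<longrightarrow> emeasure M B = 0 \<or> emeasure M (A - B) = 0))"

definition distribution_function :: "'a measure \<Rightarrow> ('a \<Rightarrow> real) \<Rightarrow> real \<Rightarrow> ennreal" where
  "distribution_function M f y = emeasure M {x \<in> space M. y < \<bar>f x\<bar>}"

text \<open>\<open>f\<^sup>*(t)\<close> for \<open>t > 0\<close>. It is \<open>\<infinity>\<close> when no level \<open>y\<close> qualifies (infimum of the empty set).\<close>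

definition rearrangement :: "'a measure \<Rightarrow> ('a \<Rightarrow> real) \<Rightarrow> real \<Rightarrow> ennreal" where
  "rearrangement M f t =
    (INF y\<in>{y. 0 \<le> y \<and> distribution_function M f y \<le> ennreal t}. ennreal y)"

text \<open>Real powers on \<open>[0, \<infinity>]\<close>, meant for exponents \<open>a > 0\<close>.\<close>

definition ennreal_powr :: "ennreal \<Rightarrow> real \<Rightarrow> ennreal" where
  "ennreal_powr x a = (if x = \<infinity> then \<infinity> else ennreal (enn2real x powr a))"

text \<open>Meant for \<open>1 < p < \<infinity>\<close> and \<open>1 \<le> s \<le> \<infinity>\<close>.\<close>

definition lorentz_norm :: "'a measure \<Rightarrow> real \<Rightarrow> ereal \<Rightarrow> ('a \<Rightarrow> real) \<Rightarrow> ennreal" where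
  "lorentz_norm M p s f =
    (if s = \<infinity> then SUP t\<in>{0<..}. ennreal (t powr (1 / p)) * rearrangement M f t
     else ennreal_powr
       (\<integral>\<^sup>+ t\<in>{0<..}. ennreal_powr (ennreal (t powr (1 / p)) * rearrangement M f t)
           (real_of_ereal s) / ennreal t \<partial>lborel)
       (1 / real_of_ereal s))"

definition lorentz_space :: "'a measure \<Rightarrow> real \<Rightarrow> ereal \<Rightarrow> ('a \<Rightarrow> real) set" where
  "lorentz_space M p s = {f \<in> borel_measurable M. lorentz_norm M p s f < \<infinity>}"

text \<open>The solution \<open>q\<close> of \<open>1/s + 1/q = 1\<close>, for \<open>1 < s \<le> \<infinity>\<close>.\<close>

definition conjugate_exponent :: "ereal \<Rightarrow> real" where
  "conjugate_exponent s =
    (if s = \<infinity> then 1 else real_of_ereal s / (real_of_ereal s - 1))"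

definition lorentz_const :: "real \<Rightarrow> ereal \<Rightarrow> real" where
  "lorentz_const p s =
    (if s = \<infinity> then 1 else (p / real_of_ereal s) powr (1 / real_of_ereal s)) *
    (conjugate_exponent (ereal p) / conjugate_exponent s) powr (1 / conjugate_exponent s)"

end

theory Submission
  imports Defs
begin

text \<open>
  Write \<open>P = p'\<close>, \<open>q = s'\<close>, let \<open>d\<close> be the distribution function of \<open>F = \<Sum>k. f k\<close> and put
  \<open>A = \<integral> d(u) powr (s/p) d(u powr s)\<close>, so that the norm of \<open>F\<close> is \<open>((p/s) A) powr (1/s)\<close>. By Hardy--Littlewood
  and Hoelder it suffices to find \<open>g\<close> whose norm in \<open>L(P,q)\<close> is at most \<open>((P/q) A) powr (1/q)\<close> and with
  \<open>A \<le> \<integral> \<bar>F\<bar> g\<close>. Take \<open>g = V(\<bar>F\<bar>) powr (1/q)\<close>, where \<open>V(y)\<close> is the integral over \<open>{0..y}\<close> of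
  \<open>d(u) powr (s/p - q/P) d(u powr s)\<close>. Hoelder on \<open>{0..y}\<close> bounds \<open>y * V(y) powr (1/q)\<close> below by the
  integral of \<open>d(u) powr (s/p - 1) d(u powr s)\<close>, and integrating \<open>\<bar>F\<bar> g\<close> over the space restores the
  missing factor \<open>d(u)\<close>. For \<open>s = \<infinity>\<close> the indicator of a level set of \<open>F\<close> plays the role of \<open>g\<close>.

  The constant is attained in the limit by the \<open>N\<close> cyclic shifts on \<open>{0..<1}\<close> of a step function
  approximating \<open>t powr (q/P - 1)\<close>: their sum is constant on \<open>{0..<1}\<close>, and its height is a Riemann sum.
\<close>

section \<open>Real powers of extended non-negative reals\<close>

lemma ennreal_powr_ennreal [simp]: "0 \<le> x \<Longrightarrow> ennreal_powr (ennreal x) a = ennreal (x powr a)"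
  by (simp add: ennreal_powr_def)

lemma ennreal_powr_top [simp]: "ennreal_powr \<infinity> a = \<infinity>" "ennreal_powr top a = top"
  by (simp_all add: ennreal_powr_def)

lemma ennreal_powr_0 [simp]: "ennreal_powr 0 a = 0"
  by (simp add: ennreal_powr_def)

lemma ennreal_powr_1 [simp]: "ennreal_powr 1 a = 1"
  by (simp add: ennreal_powr_def)

lemma ennreal_powr_one [simp]: "ennreal_powr x 1 = x"
  by (cases x) (auto simp: ennreal_powr_def)

lemma ennreal_powr_mono: "x \<le> y \<Longrightarrow> 0 \<le> a \<Longrightarrow> ennreal_powr x a \<le> ennreal_powr y a"
  by (cases x; cases y) (auto intro!: ennreal_leI powr_mono2 simp: top_unique)

lemma ennreal_powr_powr: "ennreal_powr (ennreal_powr x a) b = ennreal_powr x (a * b)"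
  by (cases x) (auto simp: powr_powr)

lemma ennreal_powr_add: "0 < a \<Longrightarrow> 0 < b \<Longrightarrow> ennreal_powr x (a + b) = ennreal_powr x a * ennreal_powr x b"
  by (cases x) (auto simp: powr_add ennreal_mult)

lemma ennreal_powr_mult: "ennreal_powr (x * y) a = ennreal_powr x a * ennreal_powr y a"
proof (cases "x = 0 \<or> y = 0")
  case False
  then show ?thesis
    by (cases x; cases y)
       (auto simp: ennreal_mult[symmetric] powr_mult ennreal_mult_top ennreal_top_mult)
qed (auto simp: ennreal_powr_def)

lemma ennreal_powr_eq_0_iff [simp]: "ennreal_powr x a = 0 \<longleftrightarrow> x = 0"
  by (cases x) auto

lemma ennreal_powr_eq_top_iff [simp]: "ennreal_powr x a = top \<longleftrightarrow> x = top"
  by (cases x) auto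

lemma ennreal_powr_less_top_iff [simp]: "ennreal_powr x a < top \<longleftrightarrow> x < top"
  by (simp add: less_top[symmetric])

lemma measurable_ennreal_powr [measurable]:
  assumes [measurable]: "f \<in> borel_measurable M"
  shows "(\<lambda>x. ennreal_powr (f x) a) \<in> borel_measurable M"
  unfolding ennreal_powr_def by measurable

text \<open>A sum is at most \<open>card I\<close> times its largest term. The crude constant does
  no harm, because the bound only serves to prove finiteness.\<close>

lemma ennreal_powr_sum_le:
  assumes "finite I" "0 < a"
  shows "ennreal_powr (\<Sum>i\<in>I. x i) a
           \<le> ennreal_powr (of_nat (card I)) a * (\<Sum>i\<in>I. ennreal_powr (x i) a)"
proof (cases "I = {}")
  case False
  define m where "m = Max (x ` I)"
  have "m \<in> x ` I" unfolding m_def using assms False by (intro Max_in) auto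
  then obtain j where j: "j \<in> I" "m = x j" by auto
  have "(\<Sum>i\<in>I. x i) \<le> of_nat (card I) * m"
    unfolding m_def using assms by (intro sum_bounded_above) auto
  then have "ennreal_powr (\<Sum>i\<in>I. x i) a \<le> ennreal_powr (of_nat (card I)) a * ennreal_powr (x j) a"
    unfolding ennreal_powr_mult[symmetric] j(2) using assms by (intro ennreal_powr_mono) auto
  also have "\<dots> \<le> ennreal_powr (of_nat (card I)) a * (\<Sum>i\<in>I. ennreal_powr (x i) a)"
    using j(1) assms by (intro mult_left_mono member_le_sum) auto
  finally show ?thesis .
qed auto

section \<open>Young's and Hoelder's inequalities with values in [0, infinity]\<close>

lemma ennreal_Young:
  assumes "1 < p" "1 < q" "1 / p + 1 / q = (1::real)"
  shows "a * b \<le> ennreal (1 / p) * ennreal_powr a p + ennreal (1 / q) * ennreal_powr b q"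
proof (cases "a = 0 \<or> b = 0 \<or> a = top \<or> b = top")
  case True
  then show ?thesis using assms by (auto simp: ennreal_mult_top)
next
  case False
  then obtain x y where xy: "a = ennreal x" "b = ennreal y" "0 \<le> x" "0 \<le> y"
    by (cases a; cases b) auto
  have "x * y \<le> x powr p / p + y powr q / q"
    using Youngs_inequality[OF assms xy(3,4)] .
  then show ?thesis
    using xy assms by (simp add: ennreal_mult[symmetric] ennreal_plus[symmetric] del: ennreal_plus)
qed

text \<open>Young's inequality for \<open>f\<close> and \<open>g\<close> divided by their norms. A
  norm that is 0 makes the product vanish almost everywhere; if neither is 0 and one is infinite,
  the right side is infinite.\<close>

lemma nn_integral_Holder:
  assumes pq: "1 < p" "1 < q" "1 / p + 1 / q = (1::real)"
    and [measurable]: "f \<in> borel_measurable M" "g \<in> borel_measurable M"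
  shows "(\<integral>\<^sup>+x. f x * g x \<partial>M) \<le>
    ennreal_powr (\<integral>\<^sup>+x. ennreal_powr (f x) p \<partial>M) (1 / p) *
    ennreal_powr (\<integral>\<^sup>+x. ennreal_powr (g x) q \<partial>M) (1 / q)"
proof -
  define A where "A = (\<integral>\<^sup>+x. ennreal_powr (f x) p \<partial>M)"
  define B where "B = (\<integral>\<^sup>+x. ennreal_powr (g x) q \<partial>M)"
  consider "A = 0" | "B = 0" | "A \<noteq> 0" "B \<noteq> 0" "A = top \<or> B = top"
    | "A \<noteq> 0" "B \<noteq> 0" "A < top" "B < top" using less_top by blast
  then show ?thesis
  proof cases
    case 1
    then have "AE x in M. f x = 0" unfolding A_def by (subst (asm) nn_integral_0_iff_AE) auto
    then have "AE x in M. f x * g x = 0" by eventually_elim auto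
    then have "(\<integral>\<^sup>+x. f x * g x \<partial>M) = 0" by (subst nn_integral_0_iff_AE) auto
    then show ?thesis by simp
  next
    case 2
    then have "AE x in M. g x = 0" unfolding B_def by (subst (asm) nn_integral_0_iff_AE) auto
    then have "AE x in M. f x * g x = 0" by eventually_elim auto
    then have "(\<integral>\<^sup>+x. f x * g x \<partial>M) = 0" by (subst nn_integral_0_iff_AE) auto
    then show ?thesis by simp
  next
    case 3
    then show ?thesis
      unfolding A_def[symmetric] B_def[symmetric] by (auto simp: ennreal_mult_top ennreal_top_mult)
  next
    case 4
    \<comment> \<open>The two norms. After division by them both power integrals equal 1, and the
      Young weights \<open>1/p\<close> and \<open>1/q\<close> add up to 1.\<close>
    define \<alpha> where "\<alpha> = enn2real A powr (1/p)"
    define \<beta> where "\<beta> = enn2real B powr (1/q)"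
    have pos: "0 < enn2real A" "0 < enn2real B"
      using 4 by (auto simp: enn2real_positive_iff zero_less_iff_neq_zero)
    have A: "A = ennreal (enn2real A)" and B: "B = ennreal (enn2real B)" using 4 by auto
    have ab: "0 < \<alpha>" "0 < \<beta>" using pos by (auto simp: \<alpha>_def \<beta>_def)
    have \<alpha>p: "(1/\<alpha>) powr p = 1 / enn2real A" and \<beta>q: "(1/\<beta>) powr q = 1 / enn2real B"
      using pq pos by (simp_all add: \<alpha>_def \<beta>_def powr_powr powr_divide)
    have "(\<integral>\<^sup>+x. f x * g x \<partial>M)
        = (\<integral>\<^sup>+x. ennreal (\<alpha> * \<beta>) * ((ennreal (1/\<alpha>) * f x) * (ennreal (1/\<beta>) * g x)) \<partial>M)"
    proof (intro nn_integral_cong)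
      fix x
      have "ennreal (\<alpha> * \<beta>) * ((ennreal (1/\<alpha>) * f x) * (ennreal (1/\<beta>) * g x))
         = ennreal (\<alpha> * \<beta>) * ennreal (1/\<alpha>) * ennreal (1/\<beta>) * (f x * g x)" by (simp add: ac_simps)
      also have "ennreal (\<alpha> * \<beta>) * ennreal (1/\<alpha>) * ennreal (1/\<beta>) = 1"
        using ab by (simp add: ennreal_mult[symmetric])
      finally show "f x * g x = ennreal (\<alpha> * \<beta>) * ((ennreal (1/\<alpha>) * f x) * (ennreal (1/\<beta>) * g x))"
        by simp
    qed
    also have "\<dots> = ennreal (\<alpha> * \<beta>) * (\<integral>\<^sup>+x. (ennreal (1/\<alpha>) * f x) * (ennreal (1/\<beta>) * g x) \<partial>M)"
      by (rule nn_integral_cmult) simp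
    also have "(\<integral>\<^sup>+x. (ennreal (1/\<alpha>) * f x) * (ennreal (1/\<beta>) * g x) \<partial>M) \<le>
      (\<integral>\<^sup>+x. ennreal (1/p) * ennreal_powr (ennreal (1/\<alpha>) * f x) p
         + ennreal (1/q) * ennreal_powr (ennreal (1/\<beta>) * g x) q \<partial>M)"
      by (intro nn_integral_mono ennreal_Young pq)
    also have "\<dots> = (\<integral>\<^sup>+x. ennreal (1/p) * (ennreal (1 / enn2real A) * ennreal_powr (f x) p)
         + ennreal (1/q) * (ennreal (1 / enn2real B) * ennreal_powr (g x) q) \<partial>M)"
      unfolding ennreal_powr_mult using ab \<alpha>p \<beta>q by simp
    also have "\<dots> = ennreal (1/p) * (ennreal (1 / enn2real A) * A)
        + ennreal (1/q) * (ennreal (1 / enn2real B) * B)"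
      by (simp add: nn_integral_add nn_integral_cmult A_def[symmetric] B_def[symmetric])
    also have "ennreal (1 / enn2real A) * A = 1"
      using pos by (subst (2) A, subst ennreal_mult[symmetric]) auto
    also have "ennreal (1 / enn2real B) * B = 1"
      using pos by (subst (2) B, subst ennreal_mult[symmetric]) auto
    also have "ennreal (1/p) * 1 + ennreal (1/q) * 1 = 1"
      using pq by (simp add: ennreal_plus[symmetric] del: ennreal_plus)
    finally have "(\<integral>\<^sup>+x. f x * g x \<partial>M) \<le> ennreal (\<alpha> * \<beta>)"
      by (simp add: mult_left_mono)
    also have "\<dots> = ennreal_powr A (1/p) * ennreal_powr B (1/q)"
      using ab 4 by (auto simp add: ennreal_mult ennreal_powr_def \<alpha>_def \<beta>_def)
    finally show ?thesis unfolding A_def B_def .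
  qed
qed

text \<open>The density of \<open>d(u powr r)\<close>, so that layer-cake integrals against it need no constants.\<close>

definition powr_weight :: "real \<Rightarrow> real \<Rightarrow> ennreal" where
  "powr_weight r u = ennreal (r * u powr (r - 1)) * indicator {0<..} u"

lemma measurable_powr_weight [measurable]: "powr_weight r \<in> borel_measurable borel"
  unfolding powr_weight_def by measurable

text \<open>Power rule for the integral of \<open>r * u powr (r - 1)\<close> up to \<open>x\<close>.
  The bound \<open>x\<close> may be infinite, since distribution functions and rearrangements, which
  are inserted for \<open>x\<close> later, may be.\<close>

lemma nn_integral_powr_weight:
  assumes "0 < r"
  shows "(\<integral>\<^sup>+u. powr_weight r u * indicator {u. ennreal u < x} u \<partial>lborel) = ennreal_powr x r"
proof -
  have fin: "(\<integral>\<^sup>+u. powr_weight r u * indicator {..<y} u \<partial>lborel) = ennreal (y powr r)" if "0 \<le> y" for y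
  proof -
    have "((\<lambda>u. u powr (r-1)) has_integral (y powr (r - 1 + 1) / (r - 1 + 1))) {0..y}"
      using assms that by (intro has_integral_powr_from_0) auto
    then have "((\<lambda>u. r * u powr (r-1)) has_integral (r * (y powr (r - 1 + 1) / (r - 1 + 1)))) {0..y}"
      by (rule has_integral_mult_right)
    then have "((\<lambda>u. r * u powr (r-1)) has_integral (y powr r)) {0..y}"
      using assms by simp
    then have *: "(\<integral>\<^sup>+u. indicator {0..y} u * ennreal (r * u powr (r-1)) \<partial>lborel) = ennreal (y powr r)"
      using nn_integral_has_integral_lebesgue[of "{0..y}" "\<lambda>u. r * u powr (r-1)" "y powr r"] assms
      by (simp add: ennreal_indicator ennreal_mult')
    have "(\<integral>\<^sup>+u. powr_weight r u * indicator {..<y} u \<partial>lborel)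
        = (\<integral>\<^sup>+u. indicator {0..y} u * ennreal (r * u powr (r-1)) \<partial>lborel)"
    proof (intro nn_integral_cong_AE)
      show "AE u in lborel. powr_weight r u * indicator {..<y} u
          = indicator {0..y} u * ennreal (r * u powr (r-1))"
        using AE_lborel_singleton[of "0::real"] AE_lborel_singleton[of y]
        by eventually_elim (auto simp: powr_weight_def indicator_def)
    qed
    with * show ?thesis by simp
  qed
  show ?thesis
  proof (cases x)
    case (real y)
    have "(\<integral>\<^sup>+u. powr_weight r u * indicator {u. ennreal u < x} u \<partial>lborel)
      = (\<integral>\<^sup>+u. powr_weight r u * indicator {..<y} u \<partial>lborel)"
      using real by (intro nn_integral_cong) (auto simp: powr_weight_def indicator_def ennreal_less_iff)
    then show ?thesis using fin real by simp
  next
    case top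
    have "ennreal (real n) \<le> (\<integral>\<^sup>+u. powr_weight r u * indicator {u. ennreal u < x} u \<partial>lborel)" for n
    proof -
      \<comment> \<open>The cut at \<open>real n powr (1/r)\<close> makes the truncated integral
        exactly \<open>n\<close>, so the full integral exceeds every natural number.\<close>
      have "ennreal (real n) = (\<integral>\<^sup>+u. powr_weight r u * indicator {..<real n powr (1/r)} u \<partial>lborel)"
        using assms by (subst fin) (auto simp: powr_powr)
      also have "\<dots> \<le> (\<integral>\<^sup>+u. powr_weight r u * indicator {u. ennreal u < x} u \<partial>lborel)"
        using top by (intro nn_integral_mono mult_left_mono) (auto simp: indicator_def)
      finally show ?thesis .
    qed
    then have "(\<integral>\<^sup>+u. powr_weight r u * indicator {u. ennreal u < x} u \<partial>lborel) = top"
      by (metis ennreal_Ex_less_of_nat ennreal_of_nat_eq_real_of_nat less_le_not_le less_top)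
    with top show ?thesis by simp
  qed
qed

lemma nn_integral_powr_weight_real:
  assumes "0 < r" "0 \<le> y"
  shows "(\<integral>\<^sup>+u. powr_weight r u * indicator {..<y} u \<partial>lborel) = ennreal (y powr r)"
proof -
  have "(\<integral>\<^sup>+u. powr_weight r u * indicator {..<y} u \<partial>lborel)
      = (\<integral>\<^sup>+u. powr_weight r u * indicator {u. ennreal u < ennreal y} u \<partial>lborel)"
    by (intro nn_integral_cong) (auto simp: powr_weight_def indicator_def ennreal_less_iff)
  then show ?thesis using nn_integral_powr_weight[OF assms(1), of "ennreal y"] assms by simp
qed

section \<open>Rearrangements\<close>

lemma powr_weight_nonpos [simp]: "u \<le> 0 \<Longrightarrow> powr_weight r u = 0"
  by (simp add: powr_weight_def)

section \<open>Duality between distribution function and rearrangement\<close>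

lemma distribution_function_antimono:
  assumes "f \<in> borel_measurable M" "x \<le> y"
  shows "distribution_function M f y \<le> distribution_function M f x"
  unfolding distribution_function_def using assms
  by (intro emeasure_mono) (auto intro: borel_measurable_less borel_measurable_abs)

lemma measurable_distribution_function [measurable]:
  assumes [measurable]: "f \<in> borel_measurable M"
  shows "distribution_function M f \<in> borel_measurable borel"
proof (rule borel_measurableI_greater)
  fix y
  have "is_interval {u. y < distribution_function M f u}"
    unfolding is_interval_1 using distribution_function_antimono[OF assms]
    by (auto intro: less_le_trans)
  then show "{u \<in> space borel. y < distribution_function M f u} \<in> sets borel"
    using real_interval_borel_measurable by simp
qed

text \<open>If the right side fails, \<open>u\<close> is an admissible level in the infimum.
  Conversely, continuity of the measure from below gives a slightly higher level whose distribution
  value still exceeds \<open>t\<close>, so the infimum stays strictly above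
  \<open>u\<close>.\<close>

lemma less_rearrangement_iff:
  assumes [measurable]: "f \<in> borel_measurable M" and u: "0 \<le> u"
  shows "ennreal u < rearrangement M f t \<longleftrightarrow> ennreal t < distribution_function M f u"
proof
  assume "ennreal u < rearrangement M f t"
  then show "ennreal t < distribution_function M f u"
    unfolding rearrangement_def using u
    by (metis (mono_tags, lifting) INF_lower leD leI mem_Collect_eq)
next
  assume t: "ennreal t < distribution_function M f u"
  \<comment> \<open>The sets with level raised by \<open>1 / (n + 1)\<close> increase to the level
    set of \<open>u\<close>, so one of them already has measure above \<open>t\<close>.\<close>
  define A where "A n = {x \<in> space M. u + 1 / real (Suc n) < \<bar>f x\<bar>}" for n
  have "incseq A"
  proof (rule incseq_SucI)
    fix n
    have "1 / real (Suc (Suc n)) \<le> 1 / real (Suc n)" by (intro divide_left_mono) auto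
    then show "A n \<le> A (Suc n)" by (auto simp: A_def)
  qed
  moreover have "(\<Union>n. A n) = {x \<in> space M. u < \<bar>f x\<bar>}"
  proof safe
    fix n x assume "x \<in> A n"
    then have "u + 1 / real (Suc n) < \<bar>f x\<bar>" "x \<in> space M" by (auto simp: A_def)
    moreover have "0 < 1 / real (Suc n)" by simp
    ultimately show "u < \<bar>f x\<bar>" "x \<in> space M" by linarith+
  next
    fix x assume x: "x \<in> space M" "u < \<bar>f x\<bar>"
    then obtain n where "1 / real (Suc n) < \<bar>f x\<bar> - u"
      using reals_Archimedean[of "\<bar>f x\<bar> - u"] by (auto simp: inverse_eq_divide)
    with x show "x \<in> (\<Union>n. A n)" by (auto simp: A_def intro!: exI[of _ n])
  qed
  moreover have "range A \<subseteq> sets M" by (auto simp: A_def)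
  ultimately have "(SUP n. emeasure M (A n)) = distribution_function M f u"
    by (simp add: SUP_emeasure_incseq distribution_function_def)
  with t obtain n where n: "ennreal t < emeasure M (A n)"
    by (metis less_SUP_iff)
  have "ennreal u < ennreal (u + 1 / real (Suc n))"
    using u by (subst ennreal_less_iff) auto
  also have "\<dots> \<le> rearrangement M f t"
    unfolding rearrangement_def
  proof (rule INF_greatest)
    fix y assume y: "y \<in> {y. 0 \<le> y \<and> distribution_function M f y \<le> ennreal t}"
    have "u + 1 / real (Suc n) \<le> y"
    proof (rule ccontr)
      assume "\<not> ?thesis"
      then have "distribution_function M f (u + 1 / real (Suc n)) \<le> distribution_function M f y"
        by (intro distribution_function_antimono) auto
      with y n show False by (auto simp: A_def distribution_function_def)
    qed
    then show "ennreal (u + 1 / real (Suc n)) \<le> ennreal y" by (rule ennreal_leI)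
  qed
  finally show "ennreal u < rearrangement M f t" .
qed

lemma measurable_rearrangement [measurable]:
  assumes [measurable]: "f \<in> borel_measurable M"
  shows "rearrangement M f \<in> borel_measurable borel"
proof (rule borel_measurableI_greater)
  fix y :: ennreal
  show "{t \<in> space borel. y < rearrangement M f t} \<in> sets borel"
  proof (cases y)
    case (real u)
    then show ?thesis using less_rearrangement_iff[OF assms, of u] by simp
  qed auto
qed

text \<open>The regions below the graphs of \<open>rearrangement M f\<close> and
  \<open>distribution_function M f\<close> are mirror images by
  \<open>less_rearrangement_iff\<close>, so Fubini moves an integral from one graph to the other.
  That equivalence is available for \<open>u \<ge> 0\<close> only, hence the condition on
  \<open>v\<close>.\<close>

lemma nn_integral_rearrangement_layer:
  assumes [measurable]: "f \<in> borel_measurable M" "v \<in> borel_measurable borel"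
    and v: "\<And>u. u \<le> 0 \<Longrightarrow> v u = 0" and w[measurable]: "w \<in> borel_measurable borel"
  shows "(\<integral>\<^sup>+t. w t * (\<integral>\<^sup>+u. v u * indicator {u. ennreal u < rearrangement M f t} u \<partial>lborel) \<partial>lborel)
    = (\<integral>\<^sup>+u. v u * (\<integral>\<^sup>+t. w t * indicator {t. ennreal t < distribution_function M f u} t \<partial>lborel) \<partial>lborel)"
proof -
  have "(\<integral>\<^sup>+t. w t * (\<integral>\<^sup>+u. v u * indicator {u. ennreal u < rearrangement M f t} u \<partial>lborel) \<partial>lborel)
     = (\<integral>\<^sup>+t. (\<integral>\<^sup>+u. w t * (v u * indicator {u. ennreal u < rearrangement M f t} u) \<partial>lborel) \<partial>lborel)"
    by (simp add: nn_integral_cmult)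
  also have "\<dots> = (\<integral>\<^sup>+t. (\<integral>\<^sup>+u. v u * (w t * indicator {t. ennreal t < distribution_function M f u} t) \<partial>lborel) \<partial>lborel)"
  proof (intro nn_integral_cong)
    fix t u
    show "w t * (v u * indicator {u. ennreal u < rearrangement M f t} u) =
      v u * (w t * indicator {t. ennreal t < distribution_function M f u} t)"
      using v[of u] less_rearrangement_iff[of f M u t]
      by (cases "u \<le> 0") (auto simp: indicator_def ac_simps)
  qed
  also have "\<dots> = (\<integral>\<^sup>+u. (\<integral>\<^sup>+t. v u * (w t * indicator {t. ennreal t < distribution_function M f u} t) \<partial>lborel) \<partial>lborel)"
    by (rule lborel_pair.Fubini') measurable
  also have "\<dots> = (\<integral>\<^sup>+u. v u * (\<integral>\<^sup>+t. w t * indicator {t. ennreal t < distribution_function M f u} t \<partial>lborel) \<partial>lborel)"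
    by (simp add: nn_integral_cmult)
  finally show ?thesis .
qed

text \<open>The measure \<open>t powr (s / p) dt / t\<close> is \<open>p / s\<close> times
  \<open>d(t powr (s / p))\<close>. Exchanging the layers then turns \<open>t\<close> into the
  distribution function and the power \<open>s\<close> of the rearrangement into the weight in
  \<open>u\<close>.\<close>

lemma lorentz_norm_distribution:
  fixes s :: real
  assumes [measurable]: "f \<in> borel_measurable M" and ps: "0 < p" "0 < s"
  shows "lorentz_norm M p (ereal s) f = ennreal_powr (ennreal (p / s) *
     (\<integral>\<^sup>+u. powr_weight s u * ennreal_powr (distribution_function M f u) (s / p) \<partial>lborel)) (1 / s)"
proof -
  have "(\<integral>\<^sup>+t\<in>{0<..}. ennreal_powr (ennreal (t powr (1 / p)) * rearrangement M f t) s / ennreal t \<partial>lborel)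
    = (\<integral>\<^sup>+t. ennreal (p / s) * (powr_weight (s / p) t * ennreal_powr (rearrangement M f t) s) \<partial>lborel)"
  proof (intro nn_integral_cong)
    fix t :: real
    show "ennreal_powr (ennreal (t powr (1 / p)) * rearrangement M f t) s / ennreal t * indicator {0<..} t
      = ennreal (p / s) * (powr_weight (s / p) t * ennreal_powr (rearrangement M f t) s)"
    proof (cases "0 < t")
      case True
      then have "ennreal (p / s) * ennreal (s / p * t powr (s / p - 1)) = ennreal (t powr (s / p) / t)"
        using ps by (simp add: ennreal_mult[symmetric] powr_diff)
      also have "\<dots> = ennreal (t powr (s / p)) / ennreal t"
        using True by (simp add: divide_ennreal)
      finally show ?thesis using True ps
        unfolding ennreal_powr_mult
        by (simp add: powr_weight_def powr_powr ennreal_divide_times ennreal_times_divide mult.assoc[symmetric])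
    qed simp
  qed
  also have "\<dots> = ennreal (p / s) * (\<integral>\<^sup>+t. powr_weight (s / p) t * ennreal_powr (rearrangement M f t) s \<partial>lborel)"
    by (simp add: nn_integral_cmult)
  also have "(\<integral>\<^sup>+t. powr_weight (s / p) t * ennreal_powr (rearrangement M f t) s \<partial>lborel)
    = (\<integral>\<^sup>+u. powr_weight s u * ennreal_powr (distribution_function M f u) (s / p) \<partial>lborel)"
    using ps nn_integral_rearrangement_layer[of f M "powr_weight s" "powr_weight (s / p)"]
    by (simp add: nn_integral_powr_weight)
  finally show ?thesis by (simp add: lorentz_norm_def)
qed

section \<open>Hardy--Littlewood inequalities\<close>

context sigma_finite_measure
begin

text \<open>By the layer-cake formula only the part of each level set inside \<open>E\<close>
  counts, and its measure is at most the minimum of \<open>emeasure M E\<close> and the distribution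
  function.\<close>

lemma set_nn_integral_le_rearrangement:
  assumes [measurable]: "f \<in> borel_measurable M" "E \<in> sets M"
  shows "(\<integral>\<^sup>+x\<in>E. ennreal \<bar>f x\<bar> \<partial>M) \<le>
    (\<integral>\<^sup>+t. powr_weight 1 t * indicator {t. ennreal t < emeasure M E} t * rearrangement M f t \<partial>lborel)"
proof -
  interpret P: pair_sigma_finite M lborel ..
  \<comment> \<open>The minimum of two bounds on \<open>t\<close> becomes a product of indicators.
    The one for \<open>E\<close> joins the weight in \<open>t\<close>, so that only the distribution
    function is left to be exchanged.\<close>
  have min: "indicator {t. ennreal t < min a b} =
      (\<lambda>t. indicator {t. ennreal t < a} t * indicator {t. ennreal t < b} t :: ennreal)" for a b
    by (auto simp: indicator_def fun_eq_iff)
  have "(\<integral>\<^sup>+x\<in>E. ennreal \<bar>f x\<bar> \<partial>M)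
    = (\<integral>\<^sup>+x. (\<integral>\<^sup>+u. powr_weight 1 u * indicator {u. ennreal u < ennreal \<bar>f x\<bar>} u * indicator E x \<partial>lborel) \<partial>M)"
    by (simp add: nn_integral_multc nn_integral_powr_weight)
  also have "\<dots> = (\<integral>\<^sup>+x. (\<integral>\<^sup>+u. powr_weight 1 u * indicator ({x\<in>space M. u < \<bar>f x\<bar>} \<inter> E) x \<partial>lborel) \<partial>M)"
  proof (intro nn_integral_cong)
    fix x u assume "x \<in> space M"
    then show "powr_weight 1 u * indicator {u. ennreal u < ennreal \<bar>f x\<bar>} u * indicator E x
      = powr_weight 1 u * indicator ({x\<in>space M. u < \<bar>f x\<bar>} \<inter> E) x"
      by (cases "u \<le> 0") (auto simp: indicator_def ennreal_less_iff)
  qed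
  also have "\<dots> = (\<integral>\<^sup>+u. (\<integral>\<^sup>+x. powr_weight 1 u * indicator ({x\<in>space M. u < \<bar>f x\<bar>} \<inter> E) x \<partial>M) \<partial>lborel)"
    by (rule P.Fubini'[symmetric]) (measurable; simp add: indicator_def)
  also have "\<dots> = (\<integral>\<^sup>+u. powr_weight 1 u * emeasure M ({x\<in>space M. u < \<bar>f x\<bar>} \<inter> E) \<partial>lborel)"
    by (simp add: nn_integral_cmult)
  also have "\<dots> \<le> (\<integral>\<^sup>+u. powr_weight 1 u * min (emeasure M E) (distribution_function M f u) \<partial>lborel)"
    unfolding distribution_function_def
    by (intro nn_integral_mono mult_left_mono) (auto intro!: emeasure_mono)
  also have "\<dots> = (\<integral>\<^sup>+u. powr_weight 1 u * (\<integral>\<^sup>+t. powr_weight 1 t *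
      indicator {t. ennreal t < min (emeasure M E) (distribution_function M f u)} t \<partial>lborel) \<partial>lborel)"
    by (simp only: nn_integral_powr_weight zero_less_one ennreal_powr_one)
  also have "\<dots> = (\<integral>\<^sup>+u. powr_weight 1 u * (\<integral>\<^sup>+t. (powr_weight 1 t * indicator {t. ennreal t < emeasure M E} t) *
      indicator {t. ennreal t < distribution_function M f u} t \<partial>lborel) \<partial>lborel)"
    by (simp only: min mult.assoc)
  also have "\<dots> = (\<integral>\<^sup>+t. (powr_weight 1 t * indicator {t. ennreal t < emeasure M E} t) * rearrangement M f t \<partial>lborel)"
    by (subst nn_integral_rearrangement_layer[symmetric]) (auto simp: nn_integral_powr_weight)
  finally show ?thesis .
qed

text \<open>The layer-cake formula for \<open>g\<close> reduces the product to integrals of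
  \<open>\<bar>f\<bar>\<close> over level sets of \<open>g\<close>, where the inequality for sets
  applies. Exchanging layers reassembles the rearrangement of \<open>g\<close>.\<close>

lemma nn_integral_mult_le_rearrangement:
  assumes [measurable]: "f \<in> borel_measurable M" "g \<in> borel_measurable M"
  shows "(\<integral>\<^sup>+x. ennreal \<bar>f x\<bar> * ennreal \<bar>g x\<bar> \<partial>M) \<le>
    (\<integral>\<^sup>+t. powr_weight 1 t * (rearrangement M f t * rearrangement M g t) \<partial>lborel)"
proof -
  interpret P: pair_sigma_finite M lborel ..
  have "(\<integral>\<^sup>+x. ennreal \<bar>f x\<bar> * ennreal \<bar>g x\<bar> \<partial>M)
    = (\<integral>\<^sup>+x. (\<integral>\<^sup>+u. ennreal \<bar>f x\<bar> * (powr_weight 1 u * indicator {u. ennreal u < ennreal \<bar>g x\<bar>} u) \<partial>lborel) \<partial>M)"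
    by (simp add: nn_integral_cmult nn_integral_powr_weight)
  also have "\<dots> = (\<integral>\<^sup>+x. (\<integral>\<^sup>+u. powr_weight 1 u * (ennreal \<bar>f x\<bar> * indicator {x\<in>space M. u < \<bar>g x\<bar>} x) \<partial>lborel) \<partial>M)"
  proof (intro nn_integral_cong)
    fix x u assume "x \<in> space M"
    then show "ennreal \<bar>f x\<bar> * (powr_weight 1 u * indicator {u. ennreal u < ennreal \<bar>g x\<bar>} u)
      = powr_weight 1 u * (ennreal \<bar>f x\<bar> * indicator {x\<in>space M. u < \<bar>g x\<bar>} x)"
      by (cases "u \<le> 0") (auto simp: indicator_def ennreal_less_iff ac_simps)
  qed
  also have "\<dots> = (\<integral>\<^sup>+u. (\<integral>\<^sup>+x. powr_weight 1 u * (ennreal \<bar>f x\<bar> * indicator {x\<in>space M. u < \<bar>g x\<bar>} x) \<partial>M) \<partial>lborel)"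
    by (rule P.Fubini'[symmetric]) (measurable; simp add: indicator_def)
  also have "\<dots> = (\<integral>\<^sup>+u. powr_weight 1 u * (\<integral>\<^sup>+x\<in>{x\<in>space M. u < \<bar>g x\<bar>}. ennreal \<bar>f x\<bar> \<partial>M) \<partial>lborel)"
    by (simp add: nn_integral_cmult)
  also have "\<dots> \<le> (\<integral>\<^sup>+u. powr_weight 1 u * (\<integral>\<^sup>+t. powr_weight 1 t * indicator {t. ennreal t < emeasure M {x\<in>space M. u < \<bar>g x\<bar>}} t * rearrangement M f t \<partial>lborel) \<partial>lborel)"
    using set_nn_integral_le_rearrangement[OF assms(1)]
    by (intro nn_integral_mono mult_left_mono) auto
  also have "\<dots> = (\<integral>\<^sup>+u. powr_weight 1 u * (\<integral>\<^sup>+t. (powr_weight 1 t * rearrangement M f t) *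
      indicator {t. ennreal t < distribution_function M g u} t \<partial>lborel) \<partial>lborel)"
    by (simp add: distribution_function_def ac_simps)
  also have "\<dots> = (\<integral>\<^sup>+t. (powr_weight 1 t * rearrangement M f t) * rearrangement M g t \<partial>lborel)"
    by (subst nn_integral_rearrangement_layer[symmetric]) (auto simp: nn_integral_powr_weight)
  finally show ?thesis by (simp add: ac_simps)
qed

end

section \<open>The triangle inequality with the sharp constant\<close>

text \<open>For \<open>r = s / p\<close> this is the quantity \<open>A\<close> of the overview:
  \<open>p / s\<close> times it is the \<open>s\<close>-th power of the Lorentz norm.\<close>

definition distribution_moment :: "'a measure \<Rightarrow> real \<Rightarrow> real \<Rightarrow> ('a \<Rightarrow> real) \<Rightarrow> ennreal" where
  "distribution_moment M s r f =
     (\<integral>\<^sup>+u. powr_weight s u * ennreal_powr (distribution_function M f u) r \<partial>lborel)"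

lemma lorentz_norm_eq_moment:
  assumes "f \<in> borel_measurable M" "0 < p" "0 < s"
  shows "lorentz_norm M p (ereal s) f
    = ennreal_powr (ennreal (p / s) * distribution_moment M s (s / p) f) (1 / s)"
  using assms by (simp add: lorentz_norm_distribution distribution_moment_def)

lemma nn_integral_rearrangement_powr:
  assumes "f \<in> borel_measurable M" "0 < a" "0 < s"
  shows "(\<integral>\<^sup>+t. powr_weight a t * ennreal_powr (rearrangement M f t) s \<partial>lborel)
    = distribution_moment M s a f"
  using assms nn_integral_rearrangement_layer[of f M "powr_weight s" "powr_weight a"]
  by (simp add: nn_integral_powr_weight distribution_moment_def)

lemma nn_integral_powr_weight_scale:
  assumes "0 < c" "0 < r" and [measurable]: "\<phi> \<in> borel_measurable borel"
  shows "(\<integral>\<^sup>+u. powr_weight r u * \<phi> (u / c) \<partial>lborel)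
    = ennreal (c powr r) * (\<integral>\<^sup>+u. powr_weight r u * \<phi> u \<partial>lborel)"
proof -
  have w: "powr_weight r (c * x) = ennreal (c powr (r - 1)) * powr_weight r x" for x
    using assms(1,2)
    by (auto simp: powr_weight_def indicator_def zero_less_mult_iff ennreal_mult[symmetric] powr_mult)
  have "(\<integral>\<^sup>+u. powr_weight r u * \<phi> (u / c) \<partial>lborel)
      = ennreal \<bar>c\<bar> * (\<integral>\<^sup>+x. powr_weight r (0 + c * x) * \<phi> ((0 + c * x) / c) \<partial>lborel)"
    using assms(1) by (intro nn_integral_real_affine) auto
  also have "\<dots> = ennreal c * (\<integral>\<^sup>+x. ennreal (c powr (r - 1)) * (powr_weight r x * \<phi> x) \<partial>lborel)"
    using assms(1) by (simp add: w mult.assoc)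
  also have "\<dots> = ennreal c * (ennreal (c powr (r - 1)) * (\<integral>\<^sup>+x. powr_weight r x * \<phi> x \<partial>lborel))"
    by (simp add: nn_integral_cmult)
  also have "\<dots> = ennreal (c powr r) * (\<integral>\<^sup>+u. powr_weight r u * \<phi> u \<partial>lborel)"
    using assms(1) by (simp add: mult.assoc[symmetric] ennreal_mult[symmetric] powr_mult_base)
  finally show ?thesis .
qed

text \<open>If the sum exceeds \<open>u\<close>, some summand exceeds its share of \<open>u\<close>.
  The shares are taken with \<open>Suc (card I)\<close> so that an empty \<open>I\<close> causes no
  division by zero.\<close>

lemma distribution_function_sum_le:
  assumes "finite I" and [measurable]: "\<And>k. k \<in> I \<Longrightarrow> f k \<in> borel_measurable M" and "0 \<le> u"
  shows "distribution_function M (\<lambda>x. \<Sum>k\<in>I. f k x) u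
     \<le> (\<Sum>k\<in>I. distribution_function M (f k) (u / real (Suc (card I))))"
proof -
  let ?u = "u / real (Suc (card I))"
  have "{x \<in> space M. u < \<bar>\<Sum>k\<in>I. f k x\<bar>} \<subseteq> (\<Union>k\<in>I. {x \<in> space M. ?u < \<bar>f k x\<bar>})"
  proof
    fix x assume x: "x \<in> {x \<in> space M. u < \<bar>\<Sum>k\<in>I. f k x\<bar>}"
    show "x \<in> (\<Union>k\<in>I. {x \<in> space M. ?u < \<bar>f k x\<bar>})"
    proof (rule ccontr)
      assume "\<not> ?thesis"
      with x have "\<And>k. k \<in> I \<Longrightarrow> \<bar>f k x\<bar> \<le> ?u" by force
      then have "(\<Sum>k\<in>I. \<bar>f k x\<bar>) \<le> real (card I) * ?u" by (rule sum_bounded_above)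
      moreover have "real (card I) * ?u \<le> u"
        using assms(3) by (simp add: field_simps)
      ultimately have "\<bar>\<Sum>k\<in>I. f k x\<bar> \<le> u" using sum_abs[of "\<lambda>k. f k x" I] by linarith
      with x show False by auto
    qed
  qed
  then have "distribution_function M (\<lambda>x. \<Sum>k\<in>I. f k x) u
      \<le> emeasure M (\<Union>k\<in>I. {x \<in> space M. ?u < \<bar>f k x\<bar>})"
    unfolding distribution_function_def using assms(1) by (intro emeasure_mono) auto
  also have "\<dots> \<le> (\<Sum>k\<in>I. distribution_function M (f k) ?u)"
    unfolding distribution_function_def using assms(1) by (intro emeasure_subadditive_finite) auto
  finally show ?thesis .
qed

text \<open>An a priori bound with a poor constant. The sharp estimate later cancels a power of the
  moment of the sum, which is legitimate only once that moment is known to be finite.\<close>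

lemma distribution_moment_sum_finite:
  assumes I: "finite I" and [measurable]: "\<And>k. k \<in> I \<Longrightarrow> f k \<in> borel_measurable M"
    and r: "0 < r" and s: "0 < s" and fin: "\<And>k. k \<in> I \<Longrightarrow> distribution_moment M s r (f k) < top"
  shows "distribution_moment M s r (\<lambda>x. \<Sum>k\<in>I. f k x) < top"
proof -
  let ?n = "real (Suc (card I))"
  let ?C = "ennreal_powr (of_nat (card I)) r"
  let ?\<phi> = "\<lambda>k u. ennreal_powr (distribution_function M (f k) u) r"
  have "distribution_moment M s r (\<lambda>x. \<Sum>k\<in>I. f k x)
      \<le> (\<integral>\<^sup>+u. ?C * (\<Sum>k\<in>I. powr_weight s u * ?\<phi> k (u / ?n)) \<partial>lborel)"
    unfolding distribution_moment_def
  proof (rule nn_integral_mono)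
    fix u :: real
    show "powr_weight s u * ennreal_powr (distribution_function M (\<lambda>x. \<Sum>k\<in>I. f k x) u) r
        \<le> ?C * (\<Sum>k\<in>I. powr_weight s u * ?\<phi> k (u / ?n))"
    proof (cases "0 < u")
      case True
      have "ennreal_powr (distribution_function M (\<lambda>x. \<Sum>k\<in>I. f k x) u) r
          \<le> ennreal_powr (\<Sum>k\<in>I. distribution_function M (f k) (u / ?n)) r"
        using True r I by (intro ennreal_powr_mono distribution_function_sum_le) auto
      also have "\<dots> \<le> ?C * (\<Sum>k\<in>I. ?\<phi> k (u / ?n))"
        by (rule ennreal_powr_sum_le[OF I r])
      finally have "powr_weight s u * ennreal_powr (distribution_function M (\<lambda>x. \<Sum>k\<in>I. f k x) u) r
          \<le> powr_weight s u * (?C * (\<Sum>k\<in>I. ?\<phi> k (u / ?n)))"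
        by (rule mult_left_mono) simp
      then show ?thesis by (simp only: sum_distrib_left mult.left_commute)
    qed simp
  qed
  also have "\<dots> = ?C * (\<Sum>k\<in>I. (\<integral>\<^sup>+u. powr_weight s u * ?\<phi> k (u / ?n) \<partial>lborel))"
    by (simp add: nn_integral_cmult nn_integral_sum)
  also have "\<dots> = ?C * (\<Sum>k\<in>I. ennreal (?n powr s) * distribution_moment M s r (f k))"
    unfolding distribution_moment_def using s
    by (intro arg_cong2[where f="(*)"] sum.cong nn_integral_powr_weight_scale refl) auto
  also have "\<dots> < top"
    using fin I by (auto simp: ennreal_mult_less_top of_nat_less_top)
  finally show ?thesis .
qed

text \<open>Arguments up to 1 are absorbed by the summand 1; beyond 1 powers grow with the exponent.
  This controls the intermediate exponent in the density of \<open>V\<close> by the moment.\<close>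

lemma ennreal_powr_le_one_plus:
  assumes "0 < e" "e \<le> r"
  shows "ennreal_powr x e \<le> 1 + ennreal_powr x r"
proof (cases "x \<le> 1")
  case True
  then have "ennreal_powr x e \<le> ennreal_powr 1 e" using assms by (intro ennreal_powr_mono) auto
  then show ?thesis by (simp add: add_increasing2)
next
  case False
  show ?thesis
  proof (cases x)
    case (real y)
    with False have "1 < y" by (simp add: ennreal_le_1 not_le)
    then have "y powr e \<le> y powr r" using assms by (intro powr_mono) auto
    then have "ennreal_powr x e \<le> ennreal_powr x r" using real by simp
    then show ?thesis by (simp add: add_increasing)
  qed simp
qed

section \<open>Duality estimate for finite \<open>s\<close>\<close>

locale lorentz_exponents =
  fixes p P s q :: real
  assumes p: "1 < p" and P: "1 < P" and pP: "1 / p + 1 / P = 1"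
    and s: "1 < s" and q: "1 < q" and sq: "1 / s + 1 / q = 1" and ps: "p < s"
begin

lemma q_less_P: "q < P"
proof -
  have "1 / s < 1 / p" using p ps by (simp add: frac_less2)
  then have "1 / P < 1 / q" using pP sq by linarith
  then show ?thesis using P q by (simp add: field_simps)
qed

text \<open>The condition \<open>p < s\<close> gives \<open>q / P < 1 < s / p\<close>. The
  difference is the exponent of \<open>d\<close> in the density of \<open>V\<close>, and real powers
  here are meant for positive exponents.\<close>

lemma gap_pos: "0 < s / p - q / P"
proof -
  have "q / P < 1" using P q_less_P by simp
  moreover have "1 < s / p" using p ps by simp
  ultimately show ?thesis by simp
qed

text \<open>The \<open>q\<close>-th root taken in Hoelder's inequality turns the exponent of the
  density into \<open>s / p - 1\<close>, exactly one short of the exponent in the moment.\<close>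

lemma gap_div: "(s / p - q / P) / q = s / p - 1"
proof -
  have "(s / p - q / P) / q = s / p * (1 / q) - 1 / P" using q by (simp add: field_simps)
  also have "1 / q = 1 - 1 / s" using sq by simp
  also have "s / p * (1 - 1 / s) - 1 / P = s / p - (1 / p + 1 / P)"
    using s p P by (simp add: field_simps)
  finally show ?thesis using pP by simp
qed

lemma Holder_rearrangement:
  assumes [measurable]: "f \<in> borel_measurable M" "g \<in> borel_measurable M"
  shows "(\<integral>\<^sup>+t. powr_weight 1 t * (rearrangement M f t * rearrangement M g t) \<partial>lborel) \<le>
    lorentz_norm M p (ereal s) f *
    ennreal_powr (ennreal (P / q) *
      (\<integral>\<^sup>+t. powr_weight (q / P) t * ennreal_powr (rearrangement M g t) q \<partial>lborel)) (1 / q)"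
proof -
  \<comment> \<open>Roots of the two Lorentz weights. Their product is 1 for \<open>t > 0\<close>:
    the powers of \<open>t\<close> cancel because both pairs of exponents are conjugate.\<close>
  let ?a = "\<lambda>t. ennreal_powr (ennreal (p / s) * powr_weight (s / p) t) (1 / s)"
  let ?b = "\<lambda>t. ennreal_powr (ennreal (P / q) * powr_weight (q / P) t) (1 / q)"
  have w: "powr_weight 1 t = ?a t * ?b t" for t
  proof (cases "0 < t")
    case True
    have 1: "(s / p - 1) * (1 / s) + (q / P - 1) * (1 / q) = 0"
    proof -
      have "(s / p - 1) * (1 / s) + (q / P - 1) * (1 / q) = (1 / p + 1 / P) - (1 / s + 1 / q)"
        using s q by (simp add: field_simps)
      then show ?thesis using pP sq by simp
    qed
    have "?a t * ?b t = ennreal (t powr ((s / p - 1) * (1 / s)) * t powr ((q / P - 1) * (1 / q)))"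
      using True p P s q by (simp add: powr_weight_def ennreal_mult[symmetric] powr_powr)
    also have "\<dots> = 1" using True by (simp only: powr_add[symmetric] 1) simp
    finally show ?thesis using True by (simp add: powr_weight_def)
  qed (simp add: powr_weight_def)
  have "(\<integral>\<^sup>+t. powr_weight 1 t * (rearrangement M f t * rearrangement M g t) \<partial>lborel)
     = (\<integral>\<^sup>+t. (?a t * rearrangement M f t) * (?b t * rearrangement M g t) \<partial>lborel)"
    by (simp add: w ac_simps)
  also have "\<dots> \<le> ennreal_powr (\<integral>\<^sup>+t. ennreal_powr (?a t * rearrangement M f t) s \<partial>lborel) (1 / s) *
    ennreal_powr (\<integral>\<^sup>+t. ennreal_powr (?b t * rearrangement M g t) q \<partial>lborel) (1 / q)"
    using s q sq by (intro nn_integral_Holder) auto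
  also have "(\<integral>\<^sup>+t. ennreal_powr (?a t * rearrangement M f t) s \<partial>lborel)
    = ennreal (p / s) * (\<integral>\<^sup>+t. powr_weight (s / p) t * ennreal_powr (rearrangement M f t) s \<partial>lborel)"
    using s by (simp add: ennreal_powr_mult ennreal_powr_powr mult.assoc nn_integral_cmult)
  also have "(\<integral>\<^sup>+t. ennreal_powr (?b t * rearrangement M g t) q \<partial>lborel)
    = ennreal (P / q) * (\<integral>\<^sup>+t. powr_weight (q / P) t * ennreal_powr (rearrangement M g t) q \<partial>lborel)"
    using q by (simp add: ennreal_powr_mult ennreal_powr_powr mult.assoc nn_integral_cmult)
  also have "(\<integral>\<^sup>+t. powr_weight (s / p) t * ennreal_powr (rearrangement M f t) s \<partial>lborel)
    = distribution_moment M s (s / p) f"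
    using p s by (intro nn_integral_rearrangement_powr) auto
  finally show ?thesis using p s by (simp add: lorentz_norm_eq_moment)
qed

text \<open>The function \<open>g\<close> is composed of \<open>\<bar>F\<bar>\<close> and an
  increasing function, so its rearrangement is governed by that of \<open>F\<close>. Finiteness of
  the moment makes \<open>V\<close> finite on the nonnegative axis, so that \<open>W\<close>, with
  its real values, represents the \<open>q\<close>-th root of \<open>V\<close> there.\<close>

lemma exists_norming_function:
  assumes "sigma_finite_measure M" and F[measurable]: "F \<in> borel_measurable M"
    and fin: "distribution_moment M s (s / p) F < top"
  obtains g :: "'a \<Rightarrow> real" where "g \<in> borel_measurable M"
    "distribution_moment M s (s / p) F \<le> (\<integral>\<^sup>+x. ennreal \<bar>F x\<bar> * ennreal \<bar>g x\<bar> \<partial>M)"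
    "(\<integral>\<^sup>+t. powr_weight (q / P) t * ennreal_powr (rearrangement M g t) q \<partial>lborel)
       \<le> distribution_moment M s (s / p) F"
proof -
  interpret sigma_finite_measure M by fact
  interpret pair: pair_sigma_finite M lborel ..
  define A where "A = distribution_moment M s (s / p) F"
  define d where "d = distribution_function M F"
  define e where "e = s / p - q / P"
  define v where "v u = powr_weight s u * ennreal_powr (d u) e" for u
  define V where "V y = (\<integral>\<^sup>+u. v u * indicator {..<y} u \<partial>lborel)" for y
  define W where "W y = enn2real (V y) powr (1 / q)" for y
  have e: "0 < e" "e / q = s / p - 1" "e + q / P = s / p" "0 < q / P"
    using gap_pos gap_div P q by (simp_all add: e_def)
  have [measurable]: "d \<in> borel_measurable borel" by (simp add: d_def)
  have [measurable]: "v \<in> borel_measurable borel" unfolding v_def[abs_def] by measurable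
  \<comment> \<open>Since \<open>e\<close> lies below \<open>s / p\<close>, the density is dominated
    by the weight itself, which integrates to \<open>y powr s\<close>, plus the integrand of the
    finite moment \<open>A\<close>.\<close>
  have Vfin: "V y < top" if "0 \<le> y" for y
  proof -
    have "V y \<le> (\<integral>\<^sup>+u. powr_weight s u * indicator {..<y} u
        + powr_weight s u * ennreal_powr (d u) (s / p) \<partial>lborel)"
      unfolding V_def
    proof (rule nn_integral_mono)
      fix u
      have "ennreal_powr (d u) e \<le> 1 + ennreal_powr (d u) (s / p)"
        using e by (intro ennreal_powr_le_one_plus) auto
      then have "v u \<le> powr_weight s u * (1 + ennreal_powr (d u) (s / p))"
        unfolding v_def by (intro mult_left_mono) auto
      then show "v u * indicator {..<y} u \<le> powr_weight s u * indicator {..<y} u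
        + powr_weight s u * ennreal_powr (d u) (s / p)"
        by (auto simp: indicator_def distrib_left)
    qed
    also have "\<dots> = ennreal (y powr s) + A"
      using s that by (simp add: nn_integral_add nn_integral_powr_weight_real A_def
          distribution_moment_def d_def)
    also have "\<dots> < top" using fin by (simp add: A_def)
    finally show ?thesis .
  qed
  have Vmono: "V x \<le> V y" if "x \<le> y" for x y
    unfolding V_def using that by (intro nn_integral_mono mult_left_mono) (auto simp: indicator_def)
  have W_eq: "ennreal (W y) = ennreal_powr (V y) (1 / q)" if "0 \<le> y" for y
    using Vfin[OF that] by (auto simp: W_def ennreal_powr_def)
  have W_mono: "W x \<le> W y" if "0 \<le> x" "x \<le> y" for x y
    unfolding W_def using that Vfin[of y] q
    by (intro powr_mono2 enn2real_mono Vmono) auto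
  have W_nonneg: "0 \<le> W y" for y by (simp add: W_def)
  define g where "g x = W \<bar>F x\<bar>" for x
  \<comment> \<open>\<open>W_mono\<close> speaks of nonnegative arguments; \<open>max 0\<close>
    extends it to the line and does not change \<open>g\<close>, where \<open>W\<close> is applied
    to an absolute value.\<close>
  have "mono (\<lambda>y. W (max 0 y))" by (intro monoI W_mono) auto
  then have [measurable]: "(\<lambda>y. W (max 0 y)) \<in> borel_measurable borel" by (rule borel_measurable_mono)
  have "(\<lambda>x. W (max 0 \<bar>F x\<bar>)) \<in> borel_measurable M" by measurable
  then have g[measurable]: "g \<in> borel_measurable M" by (simp add: g_def[abs_def])

  \<comment> \<open>Hoelder with the weight under exponent \<open>s\<close> and \<open>v\<close>
    under exponent \<open>q\<close>. The roots multiply to the integrand because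
    \<open>1 / s + 1 / q = 1\<close> and \<open>e / q = s / p - 1\<close>; the first factor
    integrates to \<open>y\<close>.\<close>
  have step1: "(\<integral>\<^sup>+u. powr_weight s u * ennreal_powr (d u) (s / p - 1) * indicator {..<y} u \<partial>lborel)
     \<le> ennreal y * ennreal (W y)" if y: "0 \<le> y" for y
  proof -
    have "(\<integral>\<^sup>+u. powr_weight s u * ennreal_powr (d u) (s / p - 1) * indicator {..<y} u \<partial>lborel)
      = (\<integral>\<^sup>+u. ennreal_powr (powr_weight s u * indicator {..<y} u) (1 / s)
           * ennreal_powr (v u * indicator {..<y} u) (1 / q) \<partial>lborel)"
    proof (intro nn_integral_cong)
      fix u
      have "ennreal_powr (powr_weight s u) (1 / s) * ennreal_powr (v u) (1 / q)
        = ennreal_powr (powr_weight s u) (1 / s + 1 / q) * ennreal_powr (d u) (e / q)"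
        using s q e by (simp add: v_def ennreal_powr_mult ennreal_powr_powr mult.assoc ennreal_powr_add)
      then show "powr_weight s u * ennreal_powr (d u) (s / p - 1) * indicator {..<y} u =
          ennreal_powr (powr_weight s u * indicator {..<y} u) (1 / s)
           * ennreal_powr (v u * indicator {..<y} u) (1 / q)"
        using e sq by (cases "u < y") (auto simp: indicator_def)
    qed
    also have "\<dots> \<le> ennreal_powr (\<integral>\<^sup>+u. ennreal_powr (ennreal_powr (powr_weight s u * indicator {..<y} u) (1 / s)) s \<partial>lborel) (1 / s)
       * ennreal_powr (\<integral>\<^sup>+u. ennreal_powr (ennreal_powr (v u * indicator {..<y} u) (1 / q)) q \<partial>lborel) (1 / q)"
      using s q sq by (intro nn_integral_Holder) auto
    also have "\<dots> = ennreal y * ennreal (W y)"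
      using s q y by (simp add: ennreal_powr_powr nn_integral_powr_weight_real V_def[symmetric] W_eq powr_powr)
    finally show ?thesis .
  qed

  \<comment> \<open>One factor \<open>d u\<close> is split off and written as the measure of a level
    set of \<open>F\<close>. Fubini then leaves, for each \<open>x\<close>, the integral of
    \<open>step1\<close> with \<open>y = \<bar>F x\<bar>\<close>.\<close>
  have "A = (\<integral>\<^sup>+u. powr_weight s u * ennreal_powr (d u) (s / p - 1) * d u \<partial>lborel)"
    unfolding A_def distribution_moment_def d_def[symmetric]
  proof (intro nn_integral_cong)
    fix u
    have "ennreal_powr (d u) (s / p - 1 + 1) = ennreal_powr (d u) (s / p - 1) * ennreal_powr (d u) 1"
      using p ps by (intro ennreal_powr_add) auto
    then show "powr_weight s u * ennreal_powr (d u) (s / p)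
      = powr_weight s u * ennreal_powr (d u) (s / p - 1) * d u"
      by (simp add: mult.assoc)
  qed
  also have "\<dots> = (\<integral>\<^sup>+u. (\<integral>\<^sup>+x. powr_weight s u * ennreal_powr (d u) (s / p - 1)
      * indicator {x\<in>space M. u < \<bar>F x\<bar>} x \<partial>M) \<partial>lborel)"
    by (simp add: nn_integral_cmult d_def distribution_function_def)
  also have "\<dots> = (\<integral>\<^sup>+x. (\<integral>\<^sup>+u. powr_weight s u * ennreal_powr (d u) (s / p - 1)
      * indicator {x\<in>space M. u < \<bar>F x\<bar>} x \<partial>lborel) \<partial>M)"
    by (rule pair.Fubini') (measurable; simp add: indicator_def)
  also have "\<dots> = (\<integral>\<^sup>+x. (\<integral>\<^sup>+u. powr_weight s u * ennreal_powr (d u) (s / p - 1)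
      * indicator {..<\<bar>F x\<bar>} u \<partial>lborel) \<partial>M)"
    by (intro nn_integral_cong) (auto simp: indicator_def)
  also have "\<dots> \<le> (\<integral>\<^sup>+x. ennreal \<bar>F x\<bar> * ennreal \<bar>g x\<bar> \<partial>M)"
    using step1 W_nonneg by (intro nn_integral_mono) (simp add: g_def)
  finally have lower: "A \<le> (\<integral>\<^sup>+x. ennreal \<bar>F x\<bar> * ennreal \<bar>g x\<bar> \<partial>M)" .

  \<comment> \<open>With \<open>y\<close> the value of the rearrangement of \<open>F\<close> at
    \<open>t\<close>, monotonicity of \<open>W\<close> places the set where \<open>g\<close> exceeds
    \<open>W y\<close> inside the set where \<open>\<bar>F\<bar>\<close> exceeds \<open>y\<close>,
    whose measure is at most \<open>t\<close>. Hence \<open>W y\<close> is an admissible level for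
    \<open>g\<close>.\<close>
  have g_star: "ennreal_powr (rearrangement M g t) q
      \<le> (\<integral>\<^sup>+u. v u * indicator {u. ennreal u < rearrangement M F t} u \<partial>lborel)" if t: "0 < t" for t
  proof (cases "rearrangement M F t")
    case (real y)
    then have "\<not> ennreal y < rearrangement M F t" by simp
    with real have "d y \<le> ennreal t"
      using less_rearrangement_iff[OF F, of y t] by (simp add: d_def not_less)
    moreover have "distribution_function M g (W y) \<le> d y"
      unfolding distribution_function_def d_def
    proof (rule emeasure_mono)
      show "{x \<in> space M. W y < \<bar>g x\<bar>} \<subseteq> {x \<in> space M. y < \<bar>F x\<bar>}"
        using W_mono[OF abs_ge_zero] W_nonneg by (force simp: g_def not_le[symmetric])
    qed auto
    ultimately have "rearrangement M g t \<le> ennreal (W y)"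
      unfolding rearrangement_def using W_nonneg by (intro INF_lower) auto
    then have "ennreal_powr (rearrangement M g t) q \<le> ennreal_powr (ennreal (W y)) q"
      using q by (intro ennreal_powr_mono) auto
    also have "\<dots> = V y" using q real by (simp add: W_eq ennreal_powr_powr del: ennreal_powr_ennreal)
    also have "\<dots> = (\<integral>\<^sup>+u. v u * indicator {u. ennreal u < rearrangement M F t} u \<partial>lborel)"
      unfolding V_def using real
      by (intro nn_integral_cong) (auto simp: v_def powr_weight_def indicator_def ennreal_less_iff)
    finally show ?thesis .
  next
    case top
    \<comment> \<open>An infinite rearrangement at \<open>t\<close> means \<open>d u > t\<close> at
      every positive level, so \<open>v\<close> dominates a positive multiple of a weight with
      infinite integral.\<close>
    have "top = ennreal (t powr e) * (\<integral>\<^sup>+u. powr_weight s u * indicator {u. ennreal u < top} u \<partial>lborel)"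
      using t s by (subst nn_integral_powr_weight) (auto simp: ennreal_mult_top)
    also have "\<dots> = (\<integral>\<^sup>+u. ennreal (t powr e) * (powr_weight s u * indicator {u. ennreal u < top} u) \<partial>lborel)"
      by (simp add: nn_integral_cmult)
    also have "\<dots> \<le> (\<integral>\<^sup>+u. v u * indicator {u. ennreal u < rearrangement M F t} u \<partial>lborel)"
    proof (rule nn_integral_mono)
      fix u :: real
      show "ennreal (t powr e) * (powr_weight s u * indicator {u. ennreal u < top} u)
        \<le> v u * indicator {u. ennreal u < rearrangement M F t} u"
      proof (cases "0 < u")
        case True
        then have "ennreal t < d u"
          using top less_rearrangement_iff[of F M u t] by (simp add: d_def)
        then have "ennreal_powr (ennreal t) e \<le> ennreal_powr (d u) e"
          using e by (intro ennreal_powr_mono) auto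
        then have "ennreal (t powr e) \<le> ennreal_powr (d u) e" using t by simp
        then show ?thesis using top
          by (simp add: v_def mult.commute mult_left_mono)
      qed simp
    qed
    finally show ?thesis by (simp add: top_unique)
  qed
  have "(\<integral>\<^sup>+t. powr_weight (q / P) t * ennreal_powr (rearrangement M g t) q \<partial>lborel)
     \<le> (\<integral>\<^sup>+t. powr_weight (q / P) t * (\<integral>\<^sup>+u. v u * indicator {u. ennreal u < rearrangement M F t} u \<partial>lborel) \<partial>lborel)"
  proof (rule nn_integral_mono)
    fix t :: real
    show "powr_weight (q / P) t * ennreal_powr (rearrangement M g t) q
      \<le> powr_weight (q / P) t * (\<integral>\<^sup>+u. v u * indicator {u. ennreal u < rearrangement M F t} u \<partial>lborel)"
      using g_star[of t] by (cases "0 < t") (auto intro: mult_left_mono)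
  qed
  \<comment> \<open>The exchange of layers contributes \<open>d u\<close> to the power
    \<open>q / P\<close>, and \<open>e + q / P = s / p\<close> recovers the moment.\<close>
  also have "\<dots> = (\<integral>\<^sup>+u. v u * ennreal_powr (d u) (q / P) \<partial>lborel)"
    using e by (subst nn_integral_rearrangement_layer) (auto simp: nn_integral_powr_weight d_def v_def)
  also have "\<dots> = A"
    using ennreal_powr_add[OF e(1,4)] unfolding A_def distribution_moment_def v_def e(3) d_def
    by (simp add: mult.assoc)
  finally show ?thesis using that[OF g] lower by (simp add: A_def)
qed

text \<open>Testing the sum against its norming function bounds \<open>A\<close> by
  \<open>(P / q) powr (1 / q)\<close> times the sum of the norms times the power
  \<open>1 / q\<close> of \<open>A\<close>. Cancelling leaves the power \<open>1 / s\<close> of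
  \<open>A\<close>, and passing from moment to norm adds
  \<open>(p / s) powr (1 / s)\<close>.\<close>

lemma lorentz_norm_sum_le:
  assumes "sigma_finite_measure M" and I: "finite I"
    and f: "\<And>k. k \<in> I \<Longrightarrow> f k \<in> borel_measurable M"
    and fin: "\<And>k. k \<in> I \<Longrightarrow> lorentz_norm M p (ereal s) (f k) < top"
  shows "lorentz_norm M p (ereal s) (\<lambda>x. \<Sum>k\<in>I. f k x)
     \<le> ennreal ((p / s) powr (1 / s) * (P / q) powr (1 / q)) * (\<Sum>k\<in>I. lorentz_norm M p (ereal s) (f k))"
proof -
  interpret sigma_finite_measure M by fact
  note f[measurable]
  define F where "F x = (\<Sum>k\<in>I. f k x)" for x
  have F[measurable]: "F \<in> borel_measurable M" unfolding F_def[abs_def] using f by (rule borel_measurable_sum)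
  define A where "A = distribution_moment M s (s / p) F"
  define K where "K = (\<Sum>k\<in>I. lorentz_norm M p (ereal s) (f k))"
  have "distribution_moment M s (s / p) (f k) < top" if "k \<in> I" for k
    using fin[OF that] f[OF that] p s
    by (auto simp: lorentz_norm_eq_moment ennreal_mult_less_top)
  then have A_fin: "A < top"
    unfolding A_def F_def using I f p s by (intro distribution_moment_sum_finite) auto
  then obtain g where g[measurable]: "g \<in> borel_measurable M"
    and lower: "A \<le> (\<integral>\<^sup>+x. ennreal \<bar>F x\<bar> * ennreal \<bar>g x\<bar> \<partial>M)"
    and upper: "(\<integral>\<^sup>+t. powr_weight (q / P) t * ennreal_powr (rearrangement M g t) q \<partial>lborel) \<le> A"
    using exists_norming_function[OF assms(1) F] unfolding A_def by blast
  let ?B = "ennreal_powr (ennreal (P / q) * A) (1 / q)"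
  note lower
  also have "(\<integral>\<^sup>+x. ennreal \<bar>F x\<bar> * ennreal \<bar>g x\<bar> \<partial>M)
      \<le> (\<integral>\<^sup>+x. (\<Sum>k\<in>I. ennreal \<bar>f k x\<bar> * ennreal \<bar>g x\<bar>) \<partial>M)"
    by (intro nn_integral_mono)
       (simp add: F_def sum_distrib_right[symmetric] sum_ennreal mult_right_mono ennreal_leI)
  also have "\<dots> = (\<Sum>k\<in>I. (\<integral>\<^sup>+x. ennreal \<bar>f k x\<bar> * ennreal \<bar>g x\<bar> \<partial>M))"
    by (simp add: nn_integral_sum)
  also have "\<dots> \<le> (\<Sum>k\<in>I. lorentz_norm M p (ereal s) (f k) * ?B)"
  proof (rule sum_mono)
    fix k assume "k \<in> I"
    then have fk: "f k \<in> borel_measurable M" by (rule f)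
    note nn_integral_mult_le_rearrangement[OF fk g]
    also note Holder_rearrangement[OF fk g]
    also have "lorentz_norm M p (ereal s) (f k) *
      ennreal_powr (ennreal (P / q) *
      (\<integral>\<^sup>+t. powr_weight (q / P) t * ennreal_powr (rearrangement M g t) q \<partial>lborel)) (1 / q)
      \<le> lorentz_norm M p (ereal s) (f k) * ?B"
      using upper q by (intro mult_left_mono ennreal_powr_mono) auto
    finally show "(\<integral>\<^sup>+x. ennreal \<bar>f k x\<bar> * ennreal \<bar>g x\<bar> \<partial>M) \<le> lorentz_norm M p (ereal s) (f k) * ?B" .
  qed
  also have "\<dots> = (ennreal ((P / q) powr (1 / q)) * K) * ennreal_powr A (1 / q)"
    using P q by (simp add: K_def sum_distrib_left sum_distrib_right ennreal_powr_mult ac_simps)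
  finally have main: "A \<le> (ennreal ((P / q) powr (1 / q)) * K) * ennreal_powr A (1 / q)" .
  \<comment> \<open>Cancelling the power \<open>1 / q\<close> of \<open>A\<close> needs
    \<open>A\<close> nonzero and finite; \<open>A_fin\<close> supplies the latter.\<close>
  have "ennreal_powr A (1 / s) \<le> ennreal ((P / q) powr (1 / q)) * K"
  proof (cases "A = 0")
    case False
    have "ennreal_powr A (1 / s) * ennreal_powr A (1 / q) = ennreal_powr A (1 / s + 1 / q)"
      using s q by (simp add: ennreal_powr_add)
    with sq main have "ennreal_powr A (1 / q) * ennreal_powr A (1 / s)
       \<le> ennreal_powr A (1 / q) * (ennreal ((P / q) powr (1 / q)) * K)"
      by (simp add: mult.commute)
    then show ?thesis
      using False A_fin by (subst (asm) ennreal_mult_le_mult_iff) auto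
  qed simp
  then have "ennreal ((p / s) powr (1 / s)) * ennreal_powr A (1 / s)
      \<le> ennreal ((p / s) powr (1 / s)) * (ennreal ((P / q) powr (1 / q)) * K)"
    by (rule mult_left_mono) simp
  moreover have "lorentz_norm M p (ereal s) F = ennreal ((p / s) powr (1 / s)) * ennreal_powr A (1 / s)"
    using p s by (simp add: lorentz_norm_eq_moment ennreal_powr_mult A_def)
  ultimately show ?thesis
    by (simp add: F_def[abs_def] K_def ennreal_mult mult.assoc)
qed

end

section \<open>The triangle inequality for \<open>s = \<infinity>\<close>\<close>

lemma (in sigma_finite_measure) weak_lorentz_norm_sum_le:
  assumes p: "1 < p" and I: "finite I"
    and f: "\<And>k. k \<in> I \<Longrightarrow> f k \<in> borel_measurable M"
  shows "lorentz_norm M p \<infinity> (\<lambda>x. \<Sum>k\<in>I. f k x)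
     \<le> ennreal (p / (p - 1)) * (\<Sum>k\<in>I. lorentz_norm M p \<infinity> (f k))"
proof -
  note f[measurable]
  define F where "F x = (\<Sum>k\<in>I. f k x)" for x
  have F[measurable]: "F \<in> borel_measurable M" unfolding F_def[abs_def] using f by (rule borel_measurable_sum)
  define K where "K = (\<Sum>k\<in>I. lorentz_norm M p \<infinity> (f k))"
  \<comment> \<open>The reciprocal of the conjugate exponent of \<open>p\<close>, so that
    \<open>1 / r\<close> is the constant sought.\<close>
  define r where "r = 1 - 1 / p"
  have r: "0 < r" "1 / r = p / (p - 1)" using p by (simp_all add: r_def field_simps)
  \<comment> \<open>The sum is at least \<open>u\<close> in absolute value on a set \<open>E\<close>
    of measure \<open>m > t\<close>, so \<open>u * m\<close> is at most the sum of the integrals of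
    \<open>\<bar>f k\<bar>\<close> over \<open>E\<close>. Each rearrangement is at most its norm
    times the power \<open>- 1 / p\<close>, whose integral up to \<open>m\<close> is
    \<open>1 / r * m powr r\<close>.\<close>
  have bound: "ennreal (t powr (1 / p)) * ennreal u \<le> ennreal (1 / r) * K"
    if t: "0 < t" and u: "0 \<le> u" "ennreal u < rearrangement M F t" for t u
  proof -
    let ?S = "{x \<in> space M. u < \<bar>F x\<bar>}"
    have S: "ennreal t < emeasure M ?S"
      using u by (simp add: less_rearrangement_iff distribution_function_def)
    \<comment> \<open>The level set may have infinite measure; sigma-finiteness then provides a
      subset of finite measure still above \<open>t\<close>, so that \<open>m powr r\<close> can be
      cancelled.\<close>
    obtain E where E[measurable]: "E \<in> sets M" "E \<subseteq> ?S" "ennreal t < emeasure M E" "emeasure M E < top"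
    proof (cases "emeasure M ?S = top")
      case True
      have "?S \<in> sets M" by measurable
      moreover have "emeasure M ?S = \<infinity>" using True by simp
      ultimately obtain Z where "Z \<in> sets M" "Z \<subseteq> ?S" "emeasure M Z < \<infinity>" "ennreal t < emeasure M Z"
        by (rule approx_PInf_emeasure_with_finite)
      then show ?thesis using that by simp
    next
      case False
      then show ?thesis using S that[of ?S] by (simp add: less_top)
    qed
    define m where "m = measure M E"
    have m: "emeasure M E = ennreal m" using E by (simp add: m_def emeasure_eq_ennreal_measure)
    then have tm: "t < m" using E(3) t by (simp add: ennreal_less_iff)
    have "ennreal u * ennreal m = (\<integral>\<^sup>+x. ennreal u * indicator E x \<partial>M)"
      by (simp add: m nn_integral_cmult_indicator)
    also have "\<dots> \<le> (\<integral>\<^sup>+x. (\<Sum>k\<in>I. ennreal \<bar>f k x\<bar> * indicator E x) \<partial>M)"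
    proof (rule nn_integral_mono)
      fix x
      have "ennreal u \<le> (\<Sum>k\<in>I. ennreal \<bar>f k x\<bar>)" if "x \<in> E"
      proof -
        have "u < \<bar>\<Sum>k\<in>I. f k x\<bar>" using that E(2) by (auto simp: F_def)
        also have "\<dots> \<le> (\<Sum>k\<in>I. \<bar>f k x\<bar>)" by (rule sum_abs)
        finally show ?thesis by (simp add: sum_ennreal ennreal_leI)
      qed
      then show "ennreal u * indicator E x \<le> (\<Sum>k\<in>I. ennreal \<bar>f k x\<bar> * indicator E x)"
        by (auto simp: indicator_def)
    qed
    also have "\<dots> = (\<Sum>k\<in>I. (\<integral>\<^sup>+x\<in>E. ennreal \<bar>f k x\<bar> \<partial>M))"
      by (simp add: nn_integral_sum)
    also have "\<dots> \<le> (\<Sum>k\<in>I. lorentz_norm M p \<infinity> (f k) * ennreal (1 / r * m powr r))"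
    proof (rule sum_mono)
      fix k assume k: "k \<in> I"
      have rearr: "rearrangement M (f k) t \<le> lorentz_norm M p \<infinity> (f k) * ennreal (t powr (- 1 / p))"
        if t: "0 < t" for t
      proof -
        have "ennreal (t powr (1 / p)) * rearrangement M (f k) t \<le> lorentz_norm M p \<infinity> (f k)"
          unfolding lorentz_norm_def using t by (auto intro: SUP_upper)
        then have "ennreal (t powr (- 1 / p)) * (ennreal (t powr (1 / p)) * rearrangement M (f k) t)
          \<le> ennreal (t powr (- 1 / p)) * lorentz_norm M p \<infinity> (f k)"
          by (rule mult_left_mono) simp
        moreover have "ennreal (t powr (- 1 / p)) * ennreal (t powr (1 / p)) = 1"
          using t by (simp add: ennreal_mult[symmetric] powr_add[symmetric])
        ultimately show ?thesis by (simp add: mult.assoc[symmetric]) (simp add: mult.commute)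
      qed
      have "(\<integral>\<^sup>+x\<in>E. ennreal \<bar>f k x\<bar> \<partial>M) \<le>
        (\<integral>\<^sup>+t. powr_weight 1 t * indicator {t. ennreal t < emeasure M E} t * rearrangement M (f k) t \<partial>lborel)"
        using k by (intro set_nn_integral_le_rearrangement) auto
      also have "\<dots> \<le> (\<integral>\<^sup>+t. (lorentz_norm M p \<infinity> (f k) * ennreal (1 / r)) *
          (powr_weight r t * indicator {t. ennreal t < emeasure M E} t) \<partial>lborel)"
      proof (rule nn_integral_mono)
        fix t :: real
        show "powr_weight 1 t * indicator {t. ennreal t < emeasure M E} t * rearrangement M (f k) t
          \<le> (lorentz_norm M p \<infinity> (f k) * ennreal (1 / r)) * (powr_weight r t * indicator {t. ennreal t < emeasure M E} t)"
        proof (cases "0 < t")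
          case True
          then have "ennreal (1 / r) * powr_weight r t = ennreal (t powr (- 1 / p))"
            using r(1) by (simp add: powr_weight_def ennreal_mult[symmetric]) (simp add: r_def)
          with rearr[OF True] True show ?thesis
            by (simp add: powr_weight_def indicator_def mult.assoc)
        qed simp
      qed
      also have "\<dots> = lorentz_norm M p \<infinity> (f k) * ennreal (1 / r * m powr r)"
        using r(1) tm t by (simp add: nn_integral_cmult nn_integral_powr_weight m mult.assoc
            ennreal_mult[symmetric])
      finally show "(\<integral>\<^sup>+x\<in>E. ennreal \<bar>f k x\<bar> \<partial>M) \<le> lorentz_norm M p \<infinity> (f k) * ennreal (1 / r * m powr r)" .
    qed
    also have "\<dots> = ennreal (m powr r) * (ennreal (1 / r) * K)"
    proof -
      have "ennreal (1 / r * m powr r) = ennreal (1 / r) * ennreal (m powr r)"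
        using r(1) by (intro ennreal_mult) auto
      then show ?thesis by (simp only: K_def sum_distrib_left ac_simps)
    qed
    finally have "ennreal u * ennreal m \<le> ennreal (m powr r) * (ennreal (1 / r) * K)" .
    \<comment> \<open>As \<open>r + 1 / p = 1\<close>, cancelling \<open>m powr r\<close> leaves
      \<open>m powr (1 / p)\<close>, which only decreases when \<open>m\<close> is replaced by
      \<open>t\<close>.\<close>
    moreover have "ennreal u * ennreal m = ennreal (m powr r) * (ennreal (m powr (1 / p)) * ennreal u)"
    proof -
      have "m = m powr r * m powr (1 / p)" using tm t by (simp add: powr_add[symmetric] r_def)
      then have "ennreal m = ennreal (m powr r) * ennreal (m powr (1 / p))"
        by (metis ennreal_mult powr_ge_zero)
      then show ?thesis by (simp add: ac_simps)
    qed
    ultimately have "ennreal (m powr (1 / p)) * ennreal u \<le> ennreal (1 / r) * K"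
      using tm t by (auto simp: ennreal_mult_le_mult_iff)
    moreover have "ennreal (t powr (1 / p)) * ennreal u \<le> ennreal (m powr (1 / p)) * ennreal u"
      using tm t p by (intro mult_right_mono ennreal_leI powr_mono2) auto
    ultimately show ?thesis by (rule order_trans[rotated])
  qed
  \<comment> \<open>\<open>bound\<close> covers real levels strictly below the rearrangement. A
    level strictly between the claimed bound and a larger rearrangement, possibly infinite, would
    contradict it.\<close>
  have "ennreal (t powr (1 / p)) * rearrangement M F t \<le> ennreal (1 / r) * K" if t: "0 < t" for t
  proof (rule ccontr)
    let ?b = "ennreal (t powr (- 1 / p)) * (ennreal (1 / r) * K)"
    have inv: "ennreal (t powr (1 / p)) * ennreal (t powr (- 1 / p)) = 1"
      using t by (simp add: ennreal_mult[symmetric] powr_add[symmetric])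
    assume neg: "\<not> ?thesis"
    have "?b < rearrangement M F t"
    proof (rule ccontr)
      assume "\<not> ?b < rearrangement M F t"
      then have "ennreal (t powr (1 / p)) * rearrangement M F t \<le> ennreal (t powr (1 / p)) * ?b"
        by (intro mult_left_mono) (auto simp: not_less)
      with neg inv show False by (simp add: mult.assoc[symmetric])
    qed
    then obtain z where z: "?b < z" "z < rearrangement M F t" using dense by blast
    then obtain u where u: "z = ennreal u" "0 \<le> u" by (cases z) auto
    have "ennreal (t powr (1 / p)) * z \<le> ennreal (1 / r) * K" using bound[OF t u(2)] z u by simp
    then have "ennreal (t powr (- 1 / p)) * (ennreal (t powr (1 / p)) * z) \<le> ?b"
      by (rule mult_left_mono) simp
    moreover have "ennreal (t powr (- 1 / p)) * (ennreal (t powr (1 / p)) * z) = z"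
      using inv by (metis mult.assoc mult.commute mult_1)
    ultimately show False using z(1) by simp
  qed
  then show ?thesis
    unfolding lorentz_norm_def F_def[symmetric] r(2)[symmetric]
    by (auto simp: K_def lorentz_norm_def intro!: SUP_least)
qed

section \<open>Optimality\<close>

lemma null_split_imp_null:
  assumes A[measurable]: "A \<in> sets (lborel :: real measure)"
    and split: "\<And>x. emeasure lborel (A \<inter> {..<x}) = 0 \<or> emeasure lborel (A \<inter> {x..}) = 0"
  shows "emeasure lborel A = 0"
proof (rule ccontr)
  assume A0: "emeasure lborel A \<noteq> 0"
  have null_Union: "emeasure lborel (\<Union>n::nat. A \<inter> B n) = 0"
    if "\<And>n. emeasure lborel (A \<inter> B n) = 0" "\<And>n. B n \<in> sets borel" for B :: "nat \<Rightarrow> real set"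
    using that A by (intro emeasure_UN_eq_0) auto
  \<comment> \<open>The cut points with only a null part of \<open>A\<close> to their left. On
    either side of \<open>z = Sup S\<close> the set \<open>A\<close> is a countable union of null
    sets, so all its mass would sit in the single point \<open>z\<close>.\<close>
  define S where "S = {x. emeasure lborel (A \<inter> {..<x}) = 0}"
  have down: "x \<in> S" if "y \<in> S" "x \<le> y" for x y
  proof -
    have "emeasure lborel (A \<inter> {..<x}) \<le> emeasure lborel (A \<inter> {..<y})"
      using that by (intro emeasure_mono) auto
    with that show ?thesis by (simp add: S_def)
  qed
  \<comment> \<open>Otherwise \<open>A\<close> would be exhausted by null sets. This bounds
    \<open>S\<close> from above; the same argument for the right halves shows that \<open>S\<close>
    is nonempty.\<close>
  have "\<exists>n::nat. real n \<notin> S"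
  proof (rule ccontr)
    assume "\<not> ?thesis"
    then have "emeasure lborel (\<Union>n::nat. A \<inter> {..<real n}) = 0"
      by (intro null_Union) (auto simp: S_def)
    moreover have "(\<Union>n::nat. A \<inter> {..<real n}) = A" using reals_Archimedean2 by auto
    ultimately show False using A0 by simp
  qed
  then obtain n where n: "real n \<notin> S" by blast
  have "\<exists>n::nat. - real n \<in> S"
  proof (rule ccontr)
    assume "\<not> ?thesis"
    then have "emeasure lborel (A \<inter> {- real n..}) = 0" for n :: nat
      using split[of "- real n"] by (auto simp: S_def)
    then have "emeasure lborel (\<Union>n::nat. A \<inter> {- real n..}) = 0"
      by (intro null_Union) auto
    moreover have "\<exists>n::nat. - real n \<le> x" for x
      using real_arch_simple[of "- x"] by (metis minus_le_iff)
    then have "(\<Union>n::nat. A \<inter> {- real n..}) = A" by auto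
    ultimately show False using A0 by simp
  qed
  then obtain m where m: "- real m \<in> S" by blast
  have bdd: "bdd_above S" using down n by (intro bdd_aboveI[of _ "real n"]) (meson linear)
  define z where "z = Sup S"
  have "emeasure lborel (\<Union>n::nat. A \<inter> {..<z - 1 / real (Suc n)}) = 0"
  proof (rule null_Union)
    fix n :: nat
    have "z - 1 / real (Suc n) < Sup S" unfolding z_def by simp
    then obtain y where "y \<in> S" "z - 1 / real (Suc n) < y"
      using less_cSup_iff[OF _ bdd] m by blast
    then show "emeasure lborel (A \<inter> {..<z - 1 / real (Suc n)}) = 0"
      using down[of y "z - 1 / real (Suc n)"] by (simp add: S_def)
  qed simp
  moreover have "(\<Union>n::nat. A \<inter> {..<z - 1 / real (Suc n)}) = A \<inter> {..<z}"
  proof safe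
    fix x n assume "x < z - 1 / real (Suc n)"
    moreover have "0 < 1 / real (Suc n)" by simp
    ultimately show "x < z" by linarith
  next
    fix x assume "x \<in> A" "x < z"
    then obtain n where "1 / real (Suc n) < z - x"
      using reals_Archimedean[of "z - x"] by (auto simp: inverse_eq_divide)
    with \<open>x \<in> A\<close> show "x \<in> (\<Union>n::nat. A \<inter> {..<z - 1 / real (Suc n)})"
      by (auto intro!: exI[of _ n])
  qed
  ultimately have 1: "emeasure lborel (A \<inter> {..<z}) = 0" by simp
  have "emeasure lborel (\<Union>n::nat. A \<inter> {z + 1 / real (Suc n)..}) = 0"
  proof (rule null_Union)
    fix n :: nat
    have "z + 1 / real (Suc n) \<notin> S"
    proof
      assume "z + 1 / real (Suc n) \<in> S"
      then have "z + 1 / real (Suc n) \<le> z" unfolding z_def using bdd by (rule cSup_upper)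
      moreover have "0 < 1 / real (Suc n)" by simp
      ultimately show False by linarith
    qed
    then show "emeasure lborel (A \<inter> {z + 1 / real (Suc n)..}) = 0"
      using split by (auto simp: S_def)
  qed simp
  moreover have "(\<Union>n::nat. A \<inter> {z + 1 / real (Suc n)..}) = A \<inter> {z<..}"
  proof safe
    fix x n assume "z + 1 / real (Suc n) \<le> x"
    moreover have "0 < 1 / real (Suc n)" by simp
    ultimately show "z < x" by linarith
  next
    fix x assume "x \<in> A" "z < x"
    then obtain n where "1 / real (Suc n) < x - z"
      using reals_Archimedean[of "x - z"] by (auto simp: inverse_eq_divide)
    with \<open>x \<in> A\<close> show "x \<in> (\<Union>n::nat. A \<inter> {z + 1 / real (Suc n)..})"
      by (auto intro!: exI[of _ n])
  qed
  ultimately have 2: "emeasure lborel (A \<inter> {z<..}) = 0" by simp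
  have 3: "emeasure lborel (A \<inter> {z}) = 0"
    using emeasure_mono[of "A \<inter> {z}" "{z}" lborel] by simp
  have "(A \<inter> {..<z}) \<union> (A \<inter> {z<..}) \<union> (A \<inter> {z}) \<in> null_sets lborel"
    by (intro null_sets.Un null_setsI 1 2 3) auto
  moreover have "(A \<inter> {..<z}) \<union> (A \<inter> {z<..}) \<union> (A \<inter> {z}) = A" by auto
  ultimately have "emeasure lborel A = 0" by (simp add: null_setsD1)
  with A0 show False by simp
qed

lemma nonatomic_lborel: "nonatomic (lborel :: real measure)"
  unfolding nonatomic_def
proof safe
  fix A :: "real set"
  assume A: "A \<in> sets lborel" "0 < emeasure lborel A"
    and *: "\<forall>B\<in>sets lborel. B \<subseteq> A \<longrightarrow> emeasure lborel B = 0 \<or> emeasure lborel (A - B) = 0"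
  have "A - A \<inter> {..<x} = A \<inter> {x..}" for x by auto
  then have "emeasure lborel (A \<inter> {..<x}) = 0 \<or> emeasure lborel (A \<inter> {x..}) = 0" for x
    using *[rule_format, of "A \<inter> {..<x}"] A by auto
  with A null_split_imp_null[of A] show False by simp
qed

section \<open>Cyclic shifts of a decreasing step function\<close>

lemma bij_betw_add_mod:
  fixes N :: nat
  shows "bij_betw (\<lambda>i. (i + c) mod N) {m..<m + N} {..<N}"
proof (cases "N = 0")
  case False
  have inj: "inj_on (\<lambda>i. (i + c) mod N) {m..<m + N}"
  proof (rule linorder_inj_onI)
    fix x y assume xy: "x < y" "x \<in> {m..<m + N}" "y \<in> {m..<m + N}"
    show "(x + c) mod N \<noteq> (y + c) mod N"
    proof
      assume "(x + c) mod N = (y + c) mod N"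
      then have "N dvd (y + c) - (x + c)" using xy by (subst mod_eq_dvd_iff_nat[symmetric]) auto
      then show False using xy by (auto dest!: dvd_imp_le)
    qed
  qed auto
  moreover have "(\<lambda>i. (i + c) mod N) ` {m..<m + N} = {..<N}"
    using False card_image[OF inj] by (intro card_subset_eq) auto
  ultimately show ?thesis by (simp add: bij_betw_def)
qed (simp add: bij_betw_def)

text \<open>The value of \<open>t powr (- a)\<close> at the right end of the \<open>j\<close>-th of
  \<open>N\<close> equal cells of the unit interval. Right ends keep the steps finite and below the
  power function.\<close>

definition step_height :: "nat \<Rightarrow> real \<Rightarrow> nat \<Rightarrow> real" where
  "step_height N a j = (real (Suc j) / real N) powr (- a)"

definition shifted_step :: "nat \<Rightarrow> real \<Rightarrow> nat \<Rightarrow> real \<Rightarrow> real" where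
  "shifted_step N a k x = step_height N a ((nat \<lfloor>real N * x\<rfloor> + k) mod N) * indicator {0..<1} x"

lemma measurable_shifted_step [measurable]: "shifted_step N a k \<in> borel_measurable borel"
  unfolding shifted_step_def by measurable

text \<open>As \<open>k\<close> runs through \<open>N\<close> consecutive values, every cell
  receives each height exactly once.\<close>

lemma sum_shifted_step:
  "(\<Sum>k=1..N. shifted_step N a k x) = (\<Sum>j<N. step_height N a j) * indicator {0..<1} x"
proof -
  have "(\<Sum>k=1..N. step_height N a ((i + k) mod N)) = (\<Sum>j<N. step_height N a j)" for i
    using sum.reindex_bij_betw[OF bij_betw_add_mod[of i N 1], of "step_height N a"]
    by (simp add: add.commute atLeastLessThanSuc_atLeastAtMost)
  then show ?thesis by (simp add: shifted_step_def sum_distrib_right[symmetric])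
qed

text \<open>A shift permutes the cells, so the number of cells of length \<open>1 / N\<close> with
  height above \<open>u\<close> does not depend on \<open>k\<close>. The upper bound is enough for
  bounding the norms.\<close>

lemma distribution_function_shifted_step:
  assumes N: "0 < N" and u: "0 \<le> u"
  shows "distribution_function lborel (shifted_step N a k) u
    \<le> ennreal (real (card {j. j < N \<and> u < step_height N a j}) / real N)"
proof -
  let ?I = "{i. i < N \<and> u < step_height N a ((i + k) mod N)}"
  let ?J = "\<lambda>i::nat. {real i / real N..<real (Suc i) / real N}"
  have "{x \<in> space lborel. u < \<bar>shifted_step N a k x\<bar>} \<subseteq> (\<Union>i\<in>?I. ?J i)"
  proof
    fix x assume "x \<in> {x \<in> space lborel. u < \<bar>shifted_step N a k x\<bar>}"
    then have x: "0 \<le> x" "x < 1" "u < step_height N a ((nat \<lfloor>real N * x\<rfloor> + k) mod N)"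
      using u by (cases "x \<in> {0..<1}"; simp add: shifted_step_def step_height_def)+
    let ?i = "nat \<lfloor>real N * x\<rfloor>"
    have "real N * x < real N" using x N by simp
    then have "?i < N" using x by (simp add: nat_less_iff floor_less_iff)
    then have "?i \<in> ?I" using x by simp
    have "real ?i = real_of_int \<lfloor>real N * x\<rfloor>" using x by simp
    then have "real ?i \<le> real N * x" "real N * x < real ?i + 1" by linarith+
    then have "real ?i / real N \<le> x" "x < real (Suc ?i) / real N"
      using N by (simp_all only: pos_divide_le_eq pos_less_divide_eq of_nat_0_less_iff of_nat_Suc ac_simps)
    then have "x \<in> ?J ?i" by simp
    with \<open>?i \<in> ?I\<close> show "x \<in> (\<Union>i\<in>?I. ?J i)" by blast
  qed
  then have "distribution_function lborel (shifted_step N a k) u \<le> emeasure lborel (\<Union>i\<in>?I. ?J i)"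
    unfolding distribution_function_def by (intro emeasure_mono) auto
  also have "\<dots> \<le> (\<Sum>i\<in>?I. emeasure lborel (?J i))"
    by (intro emeasure_subadditive_finite) auto
  also have "\<dots> = (\<Sum>i\<in>?I. ennreal (1 / real N))"
    using N by (intro sum.cong refl) (simp add: field_simps diff_divide_distrib[symmetric])
  also have "\<dots> = ennreal (real (card ?I) / real N)"
    by (simp add: ennreal_of_nat_eq_real_of_nat ennreal_mult[symmetric])
  also have "card ?I = card {j. j < N \<and> u < step_height N a j}"
  proof (rule bij_betw_same_card)
    have b: "bij_betw (\<lambda>i. (i + k) mod N) {..<N} {..<N}"
      using bij_betw_add_mod[of k N 0] by (simp add: atLeast0LessThan)
    have "(\<lambda>i. (i + k) mod N) ` ?I = {j. j < N \<and> u < step_height N a j}"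
    proof (intro equalityI subsetI)
      fix j assume j: "j \<in> {j. j < N \<and> u < step_height N a j}"
      then have "j \<in> (\<lambda>i. (i + k) mod N) ` {..<N}" using bij_betw_imp_surj_on[OF b] by simp
      then obtain i where "i < N" "j = (i + k) mod N" by auto
      with j show "j \<in> (\<lambda>i. (i + k) mod N) ` ?I" by auto
    qed (use N in auto)
    moreover have "inj_on (\<lambda>i. (i + k) mod N) ?I"
      using bij_betw_imp_inj_on[OF b] by (rule inj_on_subset) auto
    ultimately show "bij_betw (\<lambda>i. (i + k) mod N) ?I {j. j < N \<and> u < step_height N a j}"
      by (simp add: bij_betw_def)
  qed
  finally show ?thesis .
qed

text \<open>For \<open>t < 1\<close> at most \<open>N * t\<close> heights exceed
  \<open>t powr (- a)\<close>, so that value is an admissible level; for \<open>t \<ge> 1\<close>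
  level 0 is admissible, as there are only \<open>N\<close> cells.\<close>

lemma rearrangement_shifted_step:
  assumes N: "0 < N" and a: "0 < a" and t: "0 < t"
  shows "rearrangement lborel (shifted_step N a k) t \<le> ennreal (t powr (- a)) * indicator {..<1} t"
proof -
  have le: "rearrangement lborel (shifted_step N a k) t \<le> ennreal y"
    if "0 \<le> y" "real (card {j. j < N \<and> y < step_height N a j}) \<le> real N * t" for y
  proof -
    have "distribution_function lborel (shifted_step N a k) y
        \<le> ennreal (real (card {j. j < N \<and> y < step_height N a j}) / real N)"
      using N that by (intro distribution_function_shifted_step)
    also have "\<dots> \<le> ennreal t"
      using that N by (intro ennreal_leI) (simp add: field_simps)
    finally show ?thesis
      unfolding rearrangement_def using that by (intro INF_lower) auto
  qed
  show ?thesis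
  proof (cases "t < 1")
    case True
    have "{j. j < N \<and> t powr (- a) < step_height N a j} \<subseteq> {..<nat \<lfloor>real N * t\<rfloor>}"
    proof safe
      fix j assume "j < N" "t powr (- a) < step_height N a j"
      have "real (Suc j) / real N < t"
      proof (rule ccontr)
        assume "\<not> ?thesis"
        then have "(real (Suc j) / real N) powr (- a) \<le> t powr (- a)"
          using t a by (intro powr_mono2') auto
        with \<open>t powr (- a) < step_height N a j\<close> show False by (simp add: step_height_def)
      qed
      then have "real (Suc j) < real N * t" using N by (simp add: field_simps)
      \<comment> \<open>Here the right ends matter: \<open>Suc j\<close>, and not just
        \<open>j\<close>, lies below \<open>N * t\<close>, so the count does not overshoot by one
        cell.\<close>
      then have "Suc j \<le> nat \<lfloor>real N * t\<rfloor>" by (intro le_nat_floor) simp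
      then show "j < nat \<lfloor>real N * t\<rfloor>" by simp
    qed
    then have "card {j. j < N \<and> t powr (- a) < step_height N a j} \<le> nat \<lfloor>real N * t\<rfloor>"
      using card_mono[of "{..<nat \<lfloor>real N * t\<rfloor>}"] by simp
    then have "real (card {j. j < N \<and> t powr (- a) < step_height N a j}) \<le> real N * t"
      using t by (smt (verit) of_nat_floor of_nat_mono mult_nonneg_nonneg of_nat_0_le_iff)
    with le[of "t powr (- a)"] True show ?thesis by simp
  next
    case False
    have "card {j. j < N \<and> 0 < step_height N a j} \<le> N"
      using card_mono[of "{..<N}" "{j. j < N \<and> 0 < step_height N a j}"] by auto
    moreover have "real N \<le> real N * t" using False by (simp add: mult_le_cancel_left1)
    ultimately have "real (card {j. j < N \<and> 0 < step_height N a j}) \<le> real N * t" by linarith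
    with le[of 0] False show ?thesis by simp
  qed
qed

section \<open>Lower bounds for the Riemann sums\<close>

lemma sum_powr_lower_bound:
  assumes a: "0 < a" "a < 1"
  shows "(real (Suc n) powr (1 - a) - 1) / (1 - a) \<le> (\<Sum>j<n. real (Suc j) powr (- a))"
proof (induction n)
  case (Suc n)
  \<comment> \<open>The increment of \<open>x powr (1 - a)\<close> over a unit interval is at most
    \<open>1 - a\<close> times \<open>x powr (- a)\<close> at the left end, so the increments
    telescope against the sum.\<close>
  have "\<exists>z. real (Suc n) < z \<and> z < real (Suc (Suc n)) \<and>
      real (Suc (Suc n)) powr (1 - a) - real (Suc n) powr (1 - a)
        = (real (Suc (Suc n)) - real (Suc n)) * ((1 - a) * z powr (- a))"
    by (intro MVT2) (auto intro!: derivative_eq_intros)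
  then obtain z where z: "real (Suc n) < z"
    "real (Suc (Suc n)) powr (1 - a) - real (Suc n) powr (1 - a) = (1 - a) * z powr (- a)" by auto
  have "z powr (- a) \<le> real (Suc n) powr (- a)" using z a by (intro powr_mono2') auto
  then have "(real (Suc (Suc n)) powr (1 - a) - real (Suc n) powr (1 - a)) / (1 - a)
     \<le> real (Suc n) powr (- a)"
    using z a by simp
  with Suc show ?case by (simp add: diff_divide_distrib)
qed simp

text \<open>Divided by \<open>N\<close>, the sum of heights is a Riemann sum of
  \<open>t powr (- a)\<close>; the lower bound tends to the integral \<open>1 / (1 - a)\<close> over
  the unit interval.\<close>

lemma sum_step_height_lower_bound:
  assumes a: "0 < a" "a < 1" and N: "0 < N"
  shows "real N * ((1 - real N powr (a - 1)) / (1 - a)) \<le> (\<Sum>j<N. step_height N a j)"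
proof -
  have "real N * ((1 - real N powr (a - 1)) / (1 - a))
      = real N powr a * ((real N powr (1 - a) - 1) / (1 - a))"
  proof -
    have "real N powr a * real N powr (1 - a) = real N" using N by (simp add: powr_add[symmetric])
    moreover have "real N * real N powr (a - 1) = real N powr a" using N by (simp add: powr_mult_base)
    ultimately show ?thesis by (simp add: right_diff_distrib)
  qed
  also have "\<dots> \<le> real N powr a * ((real (Suc N) powr (1 - a) - 1) / (1 - a))"
    using a N by (intro mult_left_mono divide_right_mono diff_right_mono powr_mono2) auto
  also have "\<dots> \<le> real N powr a * (\<Sum>j<N. real (Suc j) powr (- a))"
    using a by (intro mult_left_mono sum_powr_lower_bound) auto
  also have "\<dots> = (\<Sum>j<N. step_height N a j)"
    using N by (simp add: sum_distrib_left step_height_def powr_divide powr_minus field_simps)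
  finally show ?thesis .
qed

text \<open>Common to finite and infinite \<open>s\<close>. \<open>K\<close> bounds the norm of each
  of the \<open>N\<close> shifts, and \<open>B\<close> is the norm per unit height of their constant
  sum, whose height is nearly \<open>N / (1 - a)\<close>; the ratio is nearly
  \<open>B / (K * (1 - a))\<close>.\<close>

lemma triangle_constant_lower_bound:
  assumes a: "0 < a" "a < 1" and B: "0 < B" and K: "0 < K" and c: "c < B / (K * (1 - a))"
    and step: "\<And>N k. 0 < N \<Longrightarrow> lorentz_norm lborel p s (shifted_step N a k) \<le> ennreal K"
    and char: "\<And>C. 0 < C \<Longrightarrow> ennreal (B * C) \<le> lorentz_norm lborel p s (\<lambda>x. C * indicator {0..<1::real} x)"
  shows "\<exists>(M :: real measure) (N :: nat) (f :: nat \<Rightarrow> real \<Rightarrow> real).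
    sigma_finite_measure M \<and> nonatomic M \<and> (\<forall>k\<in>{1..N}. f k \<in> lorentz_space M p s) \<and>
    \<not> (lorentz_norm M p s (\<lambda>x. \<Sum>k=1..N. f k x)
          \<le> ennreal c * (\<Sum>k=1..N. lorentz_norm M p s (f k)))"
proof -
  \<comment> \<open>\<open>ennreal\<close> sends a negative \<open>c\<close> to 0; the truncation
    allows the comparison to be made with real numbers.\<close>
  define c' where "c' = max 0 c"
  have c': "0 \<le> c'" "ennreal c = ennreal c'" "c' * K < B * ((1 - 0) / (1 - a))"
    using c a B K by (auto simp: c'_def max_def ennreal_neg field_simps)
  \<comment> \<open>The error term of the Riemann sum vanishes in the limit, so a large
    \<open>N\<close> beats the given constant.\<close>
  have "((\<lambda>N. real N powr (a - 1)) \<longlongrightarrow> 0) sequentially"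
    using a by (intro tendsto_neg_powr filterlim_real_sequentially) auto
  then have "((\<lambda>N. B * ((1 - real N powr (a - 1)) / (1 - a))) \<longlongrightarrow> B * ((1 - 0) / (1 - a))) sequentially"
    using a by (intro tendsto_intros) auto
  then have "\<forall>\<^sub>F N in sequentially. c' * K < B * ((1 - real N powr (a - 1)) / (1 - a))"
    using c'(3) by (rule order_tendstoD)
  then have "\<forall>\<^sub>F N in sequentially. 0 < N \<and> c' * K < B * ((1 - real N powr (a - 1)) / (1 - a))"
    using eventually_gt_at_top[of 0] by eventually_elim auto
  then obtain N where N: "0 < N" "c' * K < B * ((1 - real N powr (a - 1)) / (1 - a))"
    by (auto dest: eventually_happens)
  define C where "C = (\<Sum>j<N. step_height N a j)"
  have "c' * (real N * K) < B * (real N * ((1 - real N powr (a - 1)) / (1 - a)))"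
    using mult_strict_left_mono[OF N(2), of "real N"] N(1) by (simp add: ac_simps)
  also have "\<dots> \<le> B * C"
    unfolding C_def using a B N by (intro mult_left_mono sum_step_height_lower_bound) auto
  finally have less: "c' * (real N * K) < B * C" .
  then have C: "0 < C" using c'(1) K B by (smt (verit) mult_nonneg_nonneg of_nat_0_le_iff zero_less_mult_pos)
  have "ennreal c * (\<Sum>k=1..N. lorentz_norm lborel p s (shifted_step N a k))
      \<le> ennreal c' * (\<Sum>k=1..N. ennreal K)"
    unfolding c'(2) using step N(1) by (intro mult_left_mono sum_mono) auto
  also have "\<dots> = ennreal (c' * (real N * K))"
    using K c'(1) by (simp add: ennreal_mult ennreal_of_nat_eq_real_of_nat)
  also have "\<dots> < ennreal (B * C)"
    using less B C by (simp add: ennreal_less_iff c'(1) K less_imp_le)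
  also have "\<dots> \<le> lorentz_norm lborel p s (\<lambda>x. \<Sum>k=1..N. shifted_step N a k x)"
    unfolding sum_shifted_step C_def[symmetric] using C by (rule char)
  finally have "\<not> lorentz_norm lborel p s (\<lambda>x. \<Sum>k=1..N. shifted_step N a k x)
      \<le> ennreal c * (\<Sum>k=1..N. lorentz_norm lborel p s (shifted_step N a k))" by simp
  moreover have "shifted_step N a k \<in> lorentz_space lborel p s" for k
    unfolding lorentz_space_def using step[OF N(1), of k] by (auto intro: le_less_trans)
  ultimately show ?thesis
    using nonatomic_lborel lborel.sigma_finite_measure_axioms
    by (intro exI[of _ lborel] exI[of _ N] exI[of _ "shifted_step N a"]) auto
qed

section \<open>Norms of the test functions\<close>

lemma distribution_function_scaled_indicator:
  assumes "0 < C" "0 \<le> u"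
  shows "distribution_function lborel (\<lambda>x. C * indicator {0..<1::real} x) u = indicator {..<C} u"
proof -
  have "{x \<in> space lborel. u < \<bar>C * indicator {0..<1::real} x\<bar>} = (if u < C then {0..<1} else {})"
    using assms by (auto simp: indicator_def split: if_splits)
  then show ?thesis by (simp add: distribution_function_def)
qed

text \<open>The rearrangement is at least \<open>C\<close> for \<open>t < 1\<close> but vanishes at
  \<open>t = 1\<close>, so the norm is approached from below and never attained; this costs the
  factor \<open>t powr (1 / p)\<close>.\<close>

lemma weak_lorentz_norm_scaled_indicator:
  assumes "0 < C" "0 < p" "0 < t" "t < 1"
  shows "ennreal (t powr (1 / p) * C) \<le> lorentz_norm lborel p \<infinity> (\<lambda>x. C * indicator {0..<1::real} x)"
proof -
  let ?f = "\<lambda>x::real. C * indicator {0..<1} x"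
  have "ennreal C \<le> rearrangement lborel ?f t"
    unfolding rearrangement_def
  proof (rule INF_greatest, rule ennreal_leI)
    fix y assume y: "y \<in> {y. 0 \<le> y \<and> distribution_function lborel ?f y \<le> ennreal t}"
    show "C \<le> y"
    proof (rule ccontr)
      assume "\<not> C \<le> y"
      with y assms have "ennreal 1 \<le> ennreal t"
        using distribution_function_scaled_indicator[of C y] by simp
      with assms show False by (simp add: ennreal_le_iff)
    qed
  qed
  then have "ennreal (t powr (1 / p)) * ennreal C \<le> ennreal (t powr (1 / p)) * rearrangement lborel ?f t"
    by (rule mult_left_mono) simp
  also have "\<dots> \<le> lorentz_norm lborel p \<infinity> ?f"
    unfolding lorentz_norm_def using assms by (auto intro: SUP_upper)
  finally show ?thesis using assms by (simp add: ennreal_mult)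
qed

lemma weak_lorentz_norm_shifted_step:
  assumes N: "0 < N" and p: "0 < p"
  shows "lorentz_norm lborel p \<infinity> (shifted_step N (1 / p) k) \<le> 1"
proof -
  have "ennreal (t powr (1 / p)) * rearrangement lborel (shifted_step N (1 / p) k) t \<le> 1" if t: "0 < t" for t
  proof -
    have "ennreal (t powr (1 / p)) * rearrangement lborel (shifted_step N (1 / p) k) t
      \<le> ennreal (t powr (1 / p)) * (ennreal (t powr (- (1 / p))) * indicator {..<1} t)"
      using N p t by (intro mult_left_mono rearrangement_shifted_step) auto
    also have "\<dots> = ennreal (t powr (1 / p) * t powr (- (1 / p))) * indicator {..<1} t"
      by (simp add: ennreal_mult mult.assoc)
    also have "\<dots> \<le> 1"
      using t by (simp add: powr_add[symmetric] indicator_def)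
    finally show ?thesis .
  qed
  then show ?thesis by (auto simp: lorentz_norm_def intro: SUP_least)
qed

context lorentz_exponents
begin

lemma lorentz_norm_scaled_indicator:
  assumes C: "0 < C"
  shows "lorentz_norm lborel p (ereal s) (\<lambda>x. C * indicator {0..<1::real} x)
    = ennreal ((p / s) powr (1 / s) * C)"
proof -
  let ?f = "\<lambda>x::real. C * indicator {0..<1} x"
  have "distribution_moment lborel s (s / p) ?f = (\<integral>\<^sup>+u. powr_weight s u * indicator {..<C} u \<partial>lborel)"
    unfolding distribution_moment_def
  proof (rule nn_integral_cong)
    fix u :: real
    show "powr_weight s u * ennreal_powr (distribution_function lborel ?f u) (s / p)
        = powr_weight s u * indicator {..<C} u"
      using C p ps by (cases "0 < u"; cases "u < C") (simp_all add: distribution_function_scaled_indicator)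
  qed
  also have "\<dots> = ennreal (C powr s)"
    using s C by (simp add: nn_integral_powr_weight_real)
  finally show ?thesis
    using p s C by (simp add: lorentz_norm_eq_moment ennreal_powr_mult ennreal_mult powr_powr)
qed

text \<open>The exponent of the extremal power is \<open>a = 1 - q / P\<close>. The identity says
  that the \<open>s\<close>-th power of \<open>t powr (- a)\<close> against the weight of exponent
  \<open>s / p\<close> is, up to a factor, the weight of exponent \<open>q / P\<close>.\<close>

lemma shift_exponent: "0 < 1 - q / P" "1 - q / P < 1" "s / p - s * (1 - q / P) = q / P"
proof -
  show "0 < 1 - q / P" "1 - q / P < 1" using P q q_less_P by simp_all
  have 1: "1 / p = 1 - 1 / P" using pP by simp
  have "s * q = s + q" using sq s q by (simp add: field_simps)
  then have "s * q / P = s / P + q / P" by (simp add: add_divide_distrib)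
  moreover have "s / p = s - s / P" using 1 by (metis mult.right_neutral right_diff_distrib times_divide_eq_right)
  ultimately show "s / p - s * (1 - q / P) = q / P" by (simp add: right_diff_distrib)
qed

text \<open>The rearrangement is bounded by the extremal power on the unit interval, and
  \<open>t powr (q / P - 1)\<close> integrates to \<open>P / q\<close> there; the factors
  \<open>s / p\<close> and \<open>p / s\<close> cancel.\<close>

lemma lorentz_norm_shifted_step:
  assumes N: "0 < N"
  shows "lorentz_norm lborel p (ereal s) (shifted_step N (1 - q / P) k) \<le> ennreal ((P / q) powr (1 / s))"
proof -
  let ?f = "shifted_step N (1 - q / P) k"
  have "distribution_moment lborel s (s / p) ?f
      = (\<integral>\<^sup>+t. powr_weight (s / p) t * ennreal_powr (rearrangement lborel ?f t) s \<partial>lborel)"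
    using p s by (intro nn_integral_rearrangement_powr[symmetric]) auto
  also have "\<dots> \<le> (\<integral>\<^sup>+t. ennreal (s / p * (P / q)) * (powr_weight (q / P) t * indicator {..<1} t) \<partial>lborel)"
  proof (rule nn_integral_mono)
    fix t :: real
    show "powr_weight (s / p) t * ennreal_powr (rearrangement lborel ?f t) s
        \<le> ennreal (s / p * (P / q)) * (powr_weight (q / P) t * indicator {..<1} t)"
    proof (cases "0 < t")
      case True
      have "powr_weight (s / p) t * ennreal_powr (rearrangement lborel ?f t) s
          \<le> powr_weight (s / p) t * ennreal_powr (ennreal (t powr (- (1 - q / P))) * indicator {..<1} t) s"
        using True s N shift_exponent
        by (intro mult_left_mono ennreal_powr_mono rearrangement_shifted_step) auto
      also have "\<dots> = ennreal (s / p * (P / q)) * (powr_weight (q / P) t * indicator {..<1} t)"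
      proof (cases "t < 1")
        case 1: True
        have "powr_weight (s / p) t * ennreal_powr (ennreal (t powr (- (1 - q / P)))) s
          = ennreal (s / p * (t powr (s / p - 1) * (t powr (- (1 - q / P))) powr s))"
          using True p s by (simp add: powr_weight_def ennreal_mult[symmetric] mult.assoc)
        also have "t powr (s / p - 1) * (t powr (- (1 - q / P))) powr s = t powr (q / P - 1)"
        proof -
          have "s / p - 1 + (- (1 - q / P)) * s = q / P - 1"
            using shift_exponent(3) by (simp add: algebra_simps)
          then show ?thesis by (simp only: powr_powr powr_add[symmetric])
        qed
        also have "ennreal (s / p * t powr (q / P - 1)) = ennreal (s / p * (P / q)) * powr_weight (q / P) t"
          using True p s q P by (simp add: powr_weight_def ennreal_mult[symmetric])
        finally show ?thesis using 1 by simp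
      qed simp
      finally show ?thesis .
    qed simp
  qed
  also have "\<dots> = ennreal (s / p * (P / q))"
    using q P by (simp add: nn_integral_cmult nn_integral_powr_weight_real)
  finally have "ennreal (p / s) * distribution_moment lborel s (s / p) ?f \<le> ennreal (p / s) * ennreal (s / p * (P / q))"
    by (rule mult_left_mono) simp
  also have "\<dots> = ennreal (P / q)" using p s q P by (simp add: ennreal_mult[symmetric])
  finally have "ennreal_powr (ennreal (p / s) * distribution_moment lborel s (s / p) ?f) (1 / s)
      \<le> ennreal_powr (ennreal (P / q)) (1 / s)"
    using s by (intro ennreal_powr_mono) auto
  then show ?thesis using p s q P by (simp add: lorentz_norm_eq_moment)
qed

end

section \<open>The sharp constant for finite and for infinite \<open>s\<close>\<close>

theorem theorem6p1:
  fixes p :: real and s :: ereal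
  assumes "1 < p" and "ereal p < s"
  shows "(\<forall>(M :: 'a measure) (N :: nat) (f :: nat \<Rightarrow> 'a \<Rightarrow> real).
            sigma_finite_measure M \<and> nonatomic M \<and> (\<forall>k\<in>{1..N}. f k \<in> lorentz_space M p s) \<longrightarrow>
            lorentz_norm M p s (\<lambda>x. \<Sum>k=1..N. f k x)
              \<le> ennreal (lorentz_const p s) * (\<Sum>k=1..N. lorentz_norm M p s (f k)))
       \<and> (\<forall>c < lorentz_const p s.
            \<exists>(M :: real measure) (N :: nat) (f :: nat \<Rightarrow> real \<Rightarrow> real).
              sigma_finite_measure M \<and> nonatomic M \<and> (\<forall>k\<in>{1..N}. f k \<in> lorentz_space M p s) \<and>
              \<not> (lorentz_norm M p s (\<lambda>x. \<Sum>k=1..N. f k x)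
                    \<le> ennreal c * (\<Sum>k=1..N. lorentz_norm M p s (f k))))"
proof (cases s)
  case (real r)
  define P where "P = p / (p - 1)"
  define q where "q = r / (r - 1)"
  have pr: "1 < p" "p < r" using assms real by auto
  interpret lorentz_exponents p P r q
    by unfold_locales (use pr in \<open>simp_all add: P_def q_def field_simps\<close>)
  have const: "lorentz_const p s = (p / r) powr (1 / r) * (P / q) powr (1 / q)"
    by (simp add: lorentz_const_def conjugate_exponent_def real P_def q_def)
  \<comment> \<open>The constant in the form \<open>B / (K * (1 - a))\<close> with
    \<open>a = 1 - q / P\<close>. It uses that \<open>P / q\<close> is the product of its powers
    \<open>1 / r\<close> and \<open>1 / q\<close>.\<close>
  have const': "lorentz_const p s = (p / r) powr (1 / r) / ((P / q) powr (1 / r) * (1 - (1 - q / P)))"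
  proof -
    have "(P / q) powr (1 / r) * (P / q) powr (1 / q) = P / q"
      using P q sq by (simp add: powr_add[symmetric])
    then show ?thesis unfolding const using P q pr by (simp add: field_simps)
  qed
  show ?thesis
  proof (intro conjI allI impI)
    fix M :: "'a measure" and N :: nat and f :: "nat \<Rightarrow> 'a \<Rightarrow> real"
    assume "sigma_finite_measure M \<and> nonatomic M \<and> (\<forall>k\<in>{1..N}. f k \<in> lorentz_space M p s)"
    then show "lorentz_norm M p s (\<lambda>x. \<Sum>k=1..N. f k x)
        \<le> ennreal (lorentz_const p s) * (\<Sum>k=1..N. lorentz_norm M p s (f k))"
      unfolding const unfolding real by (intro lorentz_norm_sum_le) (auto simp: lorentz_space_def)
  next
    fix c assume "c < lorentz_const p s"
    then show "\<exists>(M :: real measure) (N :: nat) (f :: nat \<Rightarrow> real \<Rightarrow> real).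
        sigma_finite_measure M \<and> nonatomic M \<and> (\<forall>k\<in>{1..N}. f k \<in> lorentz_space M p s) \<and>
        \<not> (lorentz_norm M p s (\<lambda>x. \<Sum>k=1..N. f k x)
              \<le> ennreal c * (\<Sum>k=1..N. lorentz_norm M p s (f k)))"
      unfolding const' unfolding real using pr P q shift_exponent
      by (intro triangle_constant_lower_bound[where a="1 - q / P" and B="(p / r) powr (1 / r)"
            and K="(P / q) powr (1 / r)"] lorentz_norm_shifted_step)
         (auto simp: lorentz_norm_scaled_indicator)
  qed
next
  case PInf
  have const: "lorentz_const p s = p / (p - 1)"
    using assms by (simp add: PInf lorentz_const_def conjugate_exponent_def)
  show ?thesis
  proof (intro conjI allI impI)
    fix M :: "'a measure" and N :: nat and f :: "nat \<Rightarrow> 'a \<Rightarrow> real"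
    assume "sigma_finite_measure M \<and> nonatomic M \<and> (\<forall>k\<in>{1..N}. f k \<in> lorentz_space M p s)"
    then show "lorentz_norm M p s (\<lambda>x. \<Sum>k=1..N. f k x)
        \<le> ennreal (lorentz_const p s) * (\<Sum>k=1..N. lorentz_norm M p s (f k))"
      unfolding const unfolding PInf using assms
      by (intro sigma_finite_measure.weak_lorentz_norm_sum_le) (auto simp: lorentz_space_def)
  next
    fix c assume c: "c < lorentz_const p s"
    \<comment> \<open>\<open>y\<close> is \<open>c\<close> relative to the constant. Since the weak
      norm of an indicator is only approached, \<open>B\<close> is placed strictly between
      \<open>y\<close> and 1; the maximum with \<open>1 / 2\<close> keeps it positive when
      \<open>c\<close> is negative.\<close>
    define y where "y = c * (p - 1) / p"
    define B where "B = max (1 / 2) ((y + 1) / 2)"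
    have "y < 1" using c assms by (simp add: const y_def field_simps)
    then have B: "0 < B" "B < 1" "y < B" by (auto simp: B_def less_max_iff_disj)
    have a: "0 < 1 / p" "1 / p < 1" using assms by auto
    have "c < B / (1 * (1 - 1 / p))" using B assms by (simp add: y_def field_simps)
    \<comment> \<open>The choice \<open>t = B powr p\<close>, which is below 1, gives
      \<open>t powr (1 / p) = B\<close>.\<close>
    moreover have "ennreal (B * C) \<le> lorentz_norm lborel p \<infinity> (\<lambda>x. C * indicator {0..<1::real} x)"
      if "0 < C" for C
      using weak_lorentz_norm_scaled_indicator[OF that, of p "B powr p"] B assms
      powr_less_mono2[of p B 1] by (simp add: powr_powr)
    ultimately show "\<exists>(M :: real measure) (N :: nat) (f :: nat \<Rightarrow> real \<Rightarrow> real).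
        sigma_finite_measure M \<and> nonatomic M \<and> (\<forall>k\<in>{1..N}. f k \<in> lorentz_space M p s) \<and>
        \<not> (lorentz_norm M p s (\<lambda>x. \<Sum>k=1..N. f k x)
              \<le> ennreal c * (\<Sum>k=1..N. lorentz_norm M p s (f k)))"
      unfolding PInf using B a assms
      by (intro triangle_constant_lower_bound[where a="1 / p" and B=B and K=1])
         (auto simp: weak_lorentz_norm_shifted_step)
  qed
next
  case MInf
  with assms show ?thesis by simp
qed

end
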